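(* Suppose that $\mathfrak g=\mathfrak{so}(N)$ ($N=2n+1$ or $N=2n$), and let $\check f_{ij}\in U_q(\mathfrak g_-)\otimes\mathcal A_j$ and $\delta_j^-\in\mathcal A_j$ be as defined in the context. For all $i,j\in\{1,\dots,N\}$ such that $i\leqslant j'$, the element $\check f_{ij}$ is divisible by $\delta_j^-$, i.e. $\check f_{ij}=u\,\delta_j^-$ for some $u\in U_q(\mathfrak g_-)\otimes\mathcal A_j$.
   Context: **Quantum group.** $\mathfrak g$ is a complex simple Lie algebra $\mathfrak{so}(2n+1)$ or $\mathfrak{so}(2n)$ of rank $n$ with Cartan subalgebra $\mathfrak h$; $N=2n+1$ or $2n$. $\{\varepsilon_i\}_{i=1}^n$ is an orthonormal basis of $\mathfrak h^*$ for $(\cdot,\cdot)$; the simple roots are $\alpha_i=\varepsilon_i-\varepsilon_{i+1}$ for $i<n$ and $\alpha_n=\varepsilon_n$ or $\varepsilon_{n-1}+\varepsilon_n$, respectively. $\rho$ is the half-sum of positive roots. For $\mu\in\mathfrak h^*$, $h_\mu\in\mathfrak h$ is defined by $\beta(h_\mu)=(\mu,\beta)$. $q\in\mathbb C^\times$ is not a root of unity, $\bar q=q^{-1}$, $q^z=e^{z\log q}$ for a fixed value of $\log q$, $[z]_q=\frac{q^z-q^{-z}}{q-q^{-1}}$. $U_q(\mathfrak g_-)$ is the $\mathbb C$-algebra generated by $f_1,\dots,f_n$ ($f_i$ being the negative Chevalley generator of root $-\alpha_i$, up to a nonzero scalar) subject to the $q$-Serre relations $\sum_{k=0}^{1-a_{lm}}(-1)^k\binom{1-a_{lm}}{k}_{q_l}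 f_l^{1-a_{lm}-k}f_mf_l^k=0$ for $l\ne m$, with $a_{lm}=\frac{2(\alpha_l,\alpha_m)}{(\alpha_l,\alpha_l)}$, $q_l=q^{(\alpha_l,\alpha_l)/2}$ and $q$-binomial coefficients $\binom{m}{k}_q=\frac{[m]_q!}{[k]_q![m-k]_q!}$. $U_q(\mathfrak h)$ is the commutative algebra generated by $q^{\pm h_{\alpha_i}}$. The Borel algebra $U_q(\mathfrak b_-)$ is a free right $U_q(\mathfrak h)$-module identified with $U_q(\mathfrak g_-)\otimes U_q(\mathfrak h)$. **Poset.** $I=\{1,\dots,N\}$, $i'=N+1-i$, $*=\frac{N+1}2$, $\varepsilon_{i'}=-\varepsilon_i$ (so $\varepsilon_*=0$ for odd $N$). The partial order $\preccurlyeq$ on $I$ is the usual order $\leqslant$, except that for $\mathfrak{so}(2n)$ the elements $n$ and $n'=n+1$ are incomparable. Put $\mathrm s=n$ for $\mathfrak{so}(2n+1)$ and $\mathrm s=n-1$ for $\mathfrak{so}(2n)$. A route is a $\prec$-ascending sequence $\vec m=(m_1,\dots,m_k)$; $i\prec\vec m\prec j$ means $i\prec m_1$, $m_k\prec j$. **Elements $f_{ij}\in U_q(\mathfrak g_-)$.** Let $[x,y]_a=xy-ayx$. For $i<j\leqslant *$: $f_{ij}=[f_{j-1},\dots[f_{i+1},f_i]_{\bar q}\dots]_{\bar q}$ and $f_{j'i'}=[\dots[f_i,f_{i+1}]_{\bar q},\dots,f_{j-1}]_{\bar q}$, with $f_{i,i+1}=f_i=f_{i'-1,i'}$. Moreover: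 - $\mathfrak{so}(2n+1)$: $f_{ij'}=q^{\delta_{ij}}[f_{*,j'},f_{i,*}]_{\bar q^{\delta_{ij}}}$ for $i,j\leqslant n$ (in particular $f_{nn'}=(q-1)f_n^2$). - $\mathfrak{so}(2n)$: $f_{nn'}=0$; $f_{n-1,n'}=f_{n,n'+1}=f_n$; $f_{in'}=[f_n,f_{i,n-1}]_{\bar q}$ and $f_{ni'}=[f_{n'+1,i'},f_n]_{\bar q}$ for $i<n-1$; $f_{ji'}=q^{\delta_{ij}}[f_{ni'},f_{jn}]_{\bar q^{1+\delta_{ij}}}$ for $i,j<n$. Finally $f_{ii}=1$ and $f_{ij}=0$ for $i>j$ ($\delta_{ij}$ is the Kronecker symbol). **Elements $\hat f_{ij}$, $\check f_{ij}$.** Let $\rho_i=(\rho,\varepsilon_i)$ and $\eta_{ij}=h_{\varepsilon_i}-h_{\varepsilon_j}+\rho_i-\rho_j-\frac12\|\varepsilon_i-\varepsilon_j\|^2$. For fixed $j$ and $l\prec j$ put $y_l=q^{-2\eta_{lj}}\in U_q(\mathfrak h)$ and $A_l=A_l^j=\frac{q-\bar q}{y_l-1}$. $\mathcal A_j\subset U_q(\mathfrak h)$ is the subalgebra generated by $y_l^{\pm1}$, $l\prec j$; for $\mathfrak{so}(2n+1)$ and $j>*$ one writes $y_{j'}^{1/2}=qy_*\in\mathcal A_j$ (indeed $(qy_* )^2=y_{j'}$). Put $\hat f_{ii}=1$, $\hat f_{ij}=0$ if $i\not\preccurlyeq j$, and for $i\prec j$ let $\hat f_{ij}=\sum_{i\prec\vec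 m\prec j} f_{i,m_1}f_{m_1,m_2}\cdots f_{m_k,j}\,A_iA_{m_1}\cdots A_{m_k}$, the sum being over all routes $\vec m=(m_1,\dots,m_k)$ including the empty one (which contributes $f_{ij}A_i$). Then $\check f_{ij}=\hat f_{ij}\prod_{i\preccurlyeq l\prec j}A_l^{-1}\in U_q(\mathfrak g_-)\otimes\mathcal A_j$. **Element $\delta_j^-$.** $\delta_j^-=1$ if $j<\mathrm s'$; if $j\geqslant\mathrm s'$, then $\delta_j^-=\frac{y_{j'}-1}{q-\bar q}$ for $\mathfrak{so}(2n)$ and $\delta_j^-=\frac{y_{j'}^{1/2}+1}{q+1}$ for $\mathfrak{so}(2n+1)$. *)

theory Defs
  imports
    Complex_Main
    "HOL-Library.Poly_Mapping"
    "HOL-Computational_Algebra.Fraction_Field"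
    "HOL-Algebra.QuotRing"
begin

text \<open>
  A finitely supported function on words is an element of the free algebra on the letters;
  the wrapper type makes concatenation available as the addition that
  \<open>Poly_Mapping\<close> uses for its convolution product.
\<close>

datatype fword = FWord (letters: "nat list")

instantiation fword :: monoid_add
begin

definition zero_fword :: fword where "0 = FWord []"

definition plus_fword :: "fword \<Rightarrow> fword \<Rightarrow> fword"
  where "v + w = FWord (letters v @ letters w)"

instance
  by standard (auto simp: zero_fword_def plus_fword_def)

end

type_synonym 'k freealg = "fword \<Rightarrow>\<^sub>0 'k"

abbreviation scal :: "'k::zero \<Rightarrow> 'k freealg"
  where "scal c \<equiv> Poly_Mapping.single 0 c"

abbreviation gen :: "nat \<Rightarrow> complex freealg"
  where "gen i \<equiv> Poly_Mapping.single (FWord [i]) 1"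

definition free_ring :: "nat \<Rightarrow> 'k::comm_ring_1 freealg ring"
  where "free_ring n =
    \<lparr>carrier = {p. \<forall>w\<in>Poly_Mapping.keys p. set (letters w) \<subseteq> {1..n}},
     monoid.mult = (*), one = 1, zero = 0, add = (+)\<rparr>"

definition qcomm :: "complex freealg \<Rightarrow> complex freealg \<Rightarrow> complex \<Rightarrow> complex freealg"
  where "qcomm x y a = x * y - scal a * y * x"

definition qint :: "complex \<Rightarrow> nat \<Rightarrow> complex"
  where "qint p m = (p ^ m - inverse p ^ m) / (p - inverse p)"

definition qfact :: "complex \<Rightarrow> nat \<Rightarrow> complex"
  where "qfact p m = (\<Prod>k=1..m. qint p k)"

definition qbinom :: "complex \<Rightarrow> nat \<Rightarrow> nat \<Rightarrow> complex"
  where "qbinom p m k = qfact p m / (qfact p k * qfact p (m - k))"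

text \<open>
  An integral weight is given by its coordinates in the orthonormal basis
  \<open>\<epsilon>\<^sub>1, \<dots>, \<epsilon>\<^sub>n\<close>.  The Laurent polynomials \<open>weight \<Rightarrow>\<^sub>0 complex\<close> contain \<open>U\<^sub>q(\<hh>)\<close>
  as the span of the \<open>q\<^bsup>h\<^sub>\<mu>\<^esup>\<close> with \<open>\<mu>\<close> in the root lattice; the elements \<open>A\<^sub>l\<close> require
  denominators, so everything below takes place over the fraction field \<open>hfield\<close>.
\<close>

type_synonym weight = "nat \<Rightarrow>\<^sub>0 int"
type_synonym hfield = "(weight \<Rightarrow>\<^sub>0 complex) fract"

definition hconst :: "complex \<Rightarrow> hfield"
  where "hconst c = Fract (Poly_Mapping.single 0 c) 1"

text \<open>The pure tensor \<open>x \<otimes> a\<close>; coefficients commute with all words.\<close>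

definition tens :: "complex freealg \<Rightarrow> hfield \<Rightarrow> hfield freealg"
  where "tens x a = Poly_Mapping.map (\<lambda>c. hconst c * a) x"

text \<open>
  The parameters are \<open>N\<close> for \<open>\<ss>\<oo>(N)\<close>, of rank \<open>n = N div 2\<close>, and the chosen value of
  \<open>log q\<close>.
\<close>

locale quantum_so =
  fixes N :: nat and logq :: complex
begin

definition n :: nat where "n = N div 2"

definition qpow :: "complex \<Rightarrow> complex" where "qpow z = exp (z * logq)"

definition q :: complex where "q = qpow 1"

definition qbar :: complex where "qbar = inverse q"

definition pr :: "nat \<Rightarrow> nat" where "pr i = N + 1 - i"

definition prec :: "nat \<Rightarrow> nat \<Rightarrow> bool"
  where "prec i j \<longleftrightarrow> i < j \<and> \<not> (even N \<and> i = n \<and> j = n + 1)"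

definition preceq :: "nat \<Rightarrow> nat \<Rightarrow> bool"
  where "preceq i j \<longleftrightarrow> i = j \<or> prec i j"

definition s :: nat where "s = (if odd N then n else n - 1)"

definition eps :: "nat \<Rightarrow> weight"
  where "eps i = (if 2 * i < N + 1 then Poly_Mapping.single i 1
                  else if 2 * i > N + 1 then - Poly_Mapping.single (pr i) 1 else 0)"

definition ip :: "weight \<Rightarrow> weight \<Rightarrow> int"
  where "ip \<mu> \<nu> = (\<Sum>k=1..n. Poly_Mapping.lookup \<mu> k * Poly_Mapping.lookup \<nu> k)"

definition simple_root :: "nat \<Rightarrow> weight"
  where "simple_root i = (if i < n then eps i - eps (i + 1)
                          else if odd N then eps n else eps (n - 1) + eps n)"

definition pos_roots :: "weight set"
  where "pos_roots = {eps i - eps j |i j. 1 \<le> i \<and> i < j \<and> j \<le> n}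
                   \<union> {eps i + eps j |i j. 1 \<le> i \<and> i < j \<and> j \<le> n}
                   \<union> (if odd N then eps ` {1..n} else {})"

text \<open>\<open>\<rho>\<^sub>i = (\<rho>, \<epsilon>\<^sub>i)\<close> where \<open>\<rho>\<close> is half the sum of the positive roots.\<close>

definition rho :: "nat \<Rightarrow> complex"
  where "rho i = of_int (\<Sum>\<alpha>\<in>pos_roots. ip \<alpha> (eps i)) / 2"

text \<open>The division is exact.\<close>

definition cartan :: "nat \<Rightarrow> nat \<Rightarrow> int"
  where "cartan l m = 2 * ip (simple_root l) (simple_root m) div ip (simple_root l) (simple_root l)"

definition qroot :: "nat \<Rightarrow> complex"
  where "qroot l = qpow (of_int (ip (simple_root l) (simple_root l)) / 2)"

definition serre :: "nat \<Rightarrow> nat \<Rightarrow> complex freealg"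
  where "serre l m = (let r = nat (1 - cartan l m) in
    \<Sum>k\<le>r. scal ((-1) ^ k * qbinom (qroot l) r k) * gen l ^ (r - k) * gen m * gen l ^ k)"

definition serre_rels :: "complex freealg set"
  where "serre_rels = {serre l m |l m. l \<in> {1..n} \<and> m \<in> {1..n} \<and> l \<noteq> m}"

text \<open>
  \<open>UqK\<close> is the scalar extension of \<open>U\<^sub>q(\<gg>\<^sub>-) = \<complex>\<langle>f\<^sub>1,\<dots>,f\<^sub>n\<rangle> / (serre_rels)\<close> to
  \<open>hfield\<close>: if \<open>I\<close> denotes the two-sided ideal of Serre relations over \<open>\<complex>\<close>, then
  \<open>U\<^sub>q(\<gg>\<^sub>-) \<otimes> K = (\<complex>\<langle>f\<rangle> \<otimes> K) / (I \<otimes> K)\<close>, and \<open>I \<otimes> K\<close> is the ideal generated by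
  the same relations over \<open>K\<close>.
\<close>

definition serreK :: "hfield freealg set"
  where "serreK = genideal (free_ring n) ((\<lambda>x. tens x 1) ` serre_rels)"

definition UqK :: "hfield freealg set ring"
  where "UqK = free_ring n Quot serreK"

definition cls :: "hfield freealg \<Rightarrow> hfield freealg set"
  where "cls x = serreK +>\<^bsub>free_ring n\<^esub> x"

text \<open>
  For a subalgebra \<open>B\<close> of \<open>K\<close>, this is the subalgebra \<open>U\<^sub>q(\<gg>\<^sub>-) \<otimes> B\<close> of \<open>U\<^sub>q(\<gg>\<^sub>-) \<otimes> K\<close>.
\<close>

definition Uq_tensor :: "hfield set \<Rightarrow> hfield freealg set set"
  where "Uq_tensor B = cls ` {x \<in> carrier (free_ring n). \<forall>w. Poly_Mapping.lookup x w \<in> B}"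

text \<open>
  The elements \<open>f\<^sub>i\<^sub>j\<close>, by representatives in the free algebra.  For \<open>i < j \<le> *\<close>,
  \<open>f_lo i j\<close> is \<open>f\<^sub>i\<^sub>j\<close> and \<open>f_hi i j\<close> is \<open>f\<^bsub>j'i'\<^esub>\<close>.
\<close>

primrec f_lo :: "nat \<Rightarrow> nat \<Rightarrow> complex freealg" where
  "f_lo i 0 = 0"
| "f_lo i (Suc j) = (if i = j then gen i else if i < j then qcomm (gen j) (f_lo i j) qbar else 0)"

primrec f_hi :: "nat \<Rightarrow> nat \<Rightarrow> complex freealg" where
  "f_hi i 0 = 0"
| "f_hi i (Suc j) = (if i = j then gen i else if i < j then qcomm (f_hi i j) (gen j) qbar else 0)"

text \<open>
  \<open>f_odd i j\<close> is \<open>f\<^bsub>ij'\<^esub>\<close> for \<open>i, j \<le> n\<close> in \<open>\<ss>\<oo>(2n+1)\<close>, where \<open>* = n + 1\<close>.  The next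
  three are \<open>f\<^bsub>in'\<^esub>\<close>, \<open>f\<^bsub>ni'\<^esub>\<close>, \<open>f\<^bsub>ji'\<^esub>\<close> for \<open>i, j < n\<close> in \<open>\<ss>\<oo>(2n)\<close>; note that
  \<open>f\<^bsub>n'+1,i'\<^esub> = f\<^bsub>(n-1)',i'\<^esub>\<close>.
\<close>

definition f_odd :: "nat \<Rightarrow> nat \<Rightarrow> complex freealg"
  where "f_odd i j = (let d = (if i = j then 1 else 0) in
    scal (q ^ d) * qcomm (f_hi j (n + 1)) (f_lo i (n + 1)) (qbar ^ d))"

definition f_to_npr :: "nat \<Rightarrow> complex freealg"
  where "f_to_npr i = (if i = n - 1 then gen n else qcomm (gen n) (f_lo i (n - 1)) qbar)"

definition f_from_n :: "nat \<Rightarrow> complex freealg"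
  where "f_from_n i = (if i = n - 1 then gen n else qcomm (f_hi i (n - 1)) (gen n) qbar)"

definition f_even :: "nat \<Rightarrow> nat \<Rightarrow> complex freealg"
  where "f_even j i = (let d = (if i = j then 1 else 0) in
    scal (q ^ d) * qcomm (f_from_n i) (f_lo j n) (qbar ^ (1 + d)))"

definition f :: "nat \<Rightarrow> nat \<Rightarrow> complex freealg"
  where "f i j =
    (if i = j then 1
     else if i > j then 0
     else if 2 * j \<le> N + 1 then f_lo i j
     else if 2 * i \<ge> N + 1 then f_hi (pr j) (pr i)
     else if odd N then f_odd i (pr j)
     else if i = n \<and> j = pr n then 0
     else if j = pr n then f_to_npr i
     else if i = n then f_from_n (pr j)
     else f_even i (pr j))"

text \<open>
  \<open>q\<^bsup>h\<^sub>\<mu> + c\<^esup>\<close>.  With \<open>\<mu> = \<epsilon>\<^sub>l - \<epsilon>\<^sub>j\<close>, the exponent of \<open>y l j\<close> is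
  \<open>-2\<eta>\<^sub>l\<^sub>j = -2h\<^sub>\<mu> - 2(\<rho>\<^sub>l - \<rho>\<^sub>j - \<parallel>\<mu>\<parallel>\<^sup>2/2)\<close>.
\<close>

definition qh :: "weight \<Rightarrow> complex \<Rightarrow> hfield"
  where "qh \<mu> c = Fract (Poly_Mapping.single \<mu> (qpow c)) 1"

definition y :: "nat \<Rightarrow> nat \<Rightarrow> hfield"
  where "y l j = (let \<mu> = eps l - eps j in
    qh (- (\<mu> + \<mu>)) (- 2 * (rho l - rho j - of_int (ip \<mu> \<mu>) / 2)))"

definition A :: "nat \<Rightarrow> nat \<Rightarrow> hfield"
  where "A l j = hconst (q - qbar) / (y l j - 1)"

inductive_set alg_A :: "nat \<Rightarrow> hfield set" for j where
  "hconst c \<in> alg_A j"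
| "l \<in> {1..N} \<Longrightarrow> prec l j \<Longrightarrow> y l j \<in> alg_A j"
| "l \<in> {1..N} \<Longrightarrow> prec l j \<Longrightarrow> inverse (y l j) \<in> alg_A j"
| "a \<in> alg_A j \<Longrightarrow> b \<in> alg_A j \<Longrightarrow> a + b \<in> alg_A j"
| "a \<in> alg_A j \<Longrightarrow> b \<in> alg_A j \<Longrightarrow> a * b \<in> alg_A j"

text \<open>As \<open>\<prec>\<close> is transitive, this says that \<open>i \<prec> m\<^sub>1 \<prec> \<dots> \<prec> m\<^sub>k \<prec> j\<close>.\<close>

definition routes :: "nat \<Rightarrow> nat \<Rightarrow> nat list set"
  where "routes i j = {m. set m \<subseteq> {1..N} \<and> sorted_wrt prec (i # m @ [j])}"

primrec f_route :: "nat \<Rightarrow> nat list \<Rightarrow> nat \<Rightarrow> complex freealg" where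
  "f_route i [] j = f i j"
| "f_route i (m # ms) j = f i m * f_route m ms j"

definition fhat :: "nat \<Rightarrow> nat \<Rightarrow> hfield freealg"
  where "fhat i j =
    (if i = j then 1
     else if prec i j then (\<Sum>m\<in>routes i j. tens (f_route i m j) (\<Prod>l\<leftarrow>i # m. A l j))
     else 0)"

definition fcheck :: "nat \<Rightarrow> nat \<Rightarrow> hfield freealg set"
  where "fcheck i j =
    cls (fhat i j * scal (\<Prod>l\<in>{l \<in> {1..N}. preceq i l \<and> prec l j}. inverse (A l j)))"

text \<open>For odd \<open>N\<close>, \<open>* = n + 1\<close> and \<open>y\<^bsub>j'\<^esub>\<^bsup>1/2\<^esup>\<close> stands for \<open>q y\<^sub>*\<close>.\<close>

definition delta_minus :: "nat \<Rightarrow> hfield"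
  where "delta_minus j =
    (if j < pr s then 1
     else if even N then (y (pr j) j - 1) / hconst (q - qbar)
     else (hconst q * y (n + 1) j + 1) / hconst (q + 1))"

end

end

theory Submission
  imports Defs
begin

text \<open>
  Multiplying \<open>fhat i j\<close> by the \<open>A\<^sub>l\<^sup>-\<^sup>1\<close> turns it into a sum over paths from \<open>i\<close> to \<open>j\<close> in which every
  skipped \<open>l\<close> contributes \<open>A\<^sub>l\<^sup>-\<^sup>1\<close>.  Paths that skip \<open>j'\<close> are divisible by \<open>A\<^bsub>j'\<^esub>\<^sup>-\<^sup>1\<close>, hence by
  \<open>\<delta>\<^sub>j\<^sup>-\<close>, and the remaining ones factor through the path sum from \<open>j'\<close> to \<open>j\<close>.  So it suffices that the
  path sum from \<open>a\<close> to \<open>a'\<close> vanishes modulo \<open>\<delta>\<^sub>j\<^sup>-\<close> for all \<open>j' \<le> a \<le> s\<close>, where the weights \<open>\<alpha>\<^sub>l = A\<^sub>l\<^sup>-\<^sup>1\<close>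
  satisfy \<open>\<alpha>\<^sub>l + \<alpha>\<^bsub>l'\<^esub> + (q - q\<^sup>-\<^sup>1) \<alpha>\<^sub>l \<alpha>\<^bsub>l'\<^esub> = \<alpha>\<^bsub>j'\<^esub> \<equiv> 0\<close> because \<open>y\<^sub>l y\<^bsub>l'\<^esub> = y\<^bsub>j'\<^esub>\<close>.

  This goes by downward induction on \<open>a\<close>.  With \<open>e = f\<^sub>a\<close> and \<open>b = a + 1\<close>, one has \<open>f\<^sub>a\<^sub>k = [f\<^sub>b\<^sub>k, e]\<close> and
  \<open>f\<^bsub>ma'\<^esub> = [e, f\<^bsub>mb'\<^esub>]\<close> (\<open>q\<^sup>-\<^sup>1\<close>-commutators) for all \<open>k\<close>, \<open>m\<close> strictly between \<open>b\<close> and \<open>b'\<close>, the elements between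
  them commute with \<open>e\<close>, and \<open>e\<close> satisfies the quadratic Serre relation with \<open>f\<^sub>b\<^sub>k\<close> and \<open>f\<^bsub>mb'\<^esub>\<close>.  This expresses the
  path sum at \<open>a\<close> through the one at \<open>b\<close> and the sum \<open>Z\<close> that has an extra \<open>e\<close> in the middle; only the
  commutator \<open>[e, Z]\<close> survives, and the Serre relations determine it.
\<close>


subsection \<open>Congruences modulo a two-sided ideal\<close>

text \<open>\<open>M\<close> stands for an algebra with coefficients in a subring \<open>B\<close>
  of the field, \<open>J\<close> for what is to be neglected. \<open>J\<close> is stable under
  \<open>B\<close> and \<open>M\<close> only and need not lie in \<open>M\<close>: in the
  application it contains the Serre ideal over the whole field. Congruences therefore have to keep
  track of membership in \<open>M\<close>.\<close>

locale cong_algebra = module scale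
  for scale :: "'k::field \<Rightarrow> 'r::ring_1 \<Rightarrow> 'r"  (infixr "*s" 75) +
  fixes B :: "'k set" and M J :: "'r set"
  assumes scale_mult_left [simp]: "(c *s x) * z = c *s (x * z)"
    and scale_mult_right [simp]: "x * (c *s z) = c *s (x * z)"
    and B_1 [intro, simp]: "1 \<in> B"
    and B_uminus [intro, simp]: "c \<in> B \<Longrightarrow> - c \<in> B"
    and B_add [intro, simp]: "c \<in> B \<Longrightarrow> d \<in> B \<Longrightarrow> c + d \<in> B"
    and B_mult [intro, simp]: "c \<in> B \<Longrightarrow> d \<in> B \<Longrightarrow> c * d \<in> B"
    and M_1 [intro, simp]: "1 \<in> M"
    and M_add [intro, simp]: "x \<in> M \<Longrightarrow> z \<in> M \<Longrightarrow> x + z \<in> M"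
    and M_mult [intro, simp]: "x \<in> M \<Longrightarrow> z \<in> M \<Longrightarrow> x * z \<in> M"
    and M_scale [intro, simp]: "c \<in> B \<Longrightarrow> x \<in> M \<Longrightarrow> c *s x \<in> M"
    and J_0 [intro, simp]: "0 \<in> J"
    and J_add [intro, simp]: "x \<in> J \<Longrightarrow> z \<in> J \<Longrightarrow> x + z \<in> J"
    and J_scale [intro, simp]: "c \<in> B \<Longrightarrow> x \<in> J \<Longrightarrow> c *s x \<in> J"
    and J_mult_left [intro, simp]: "x \<in> M \<Longrightarrow> z \<in> J \<Longrightarrow> x * z \<in> J"
    and J_mult_right [intro, simp]: "x \<in> J \<Longrightarrow> z \<in> M \<Longrightarrow> x * z \<in> J"
begin

lemma B_diff [intro, simp]: "c \<in> B \<Longrightarrow> d \<in> B \<Longrightarrow> c - d \<in> B"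
  using B_add[of c "- d"] by simp

lemma B_0 [intro, simp]: "0 \<in> B"
  using B_diff[of 1 1] by simp

lemma B_prod_list: "(\<And>x. x \<in> set xs \<Longrightarrow> x \<in> B) \<Longrightarrow> prod_list xs \<in> B"
  by (induction xs) auto

lemma M_uminus [intro, simp]: "x \<in> M \<Longrightarrow> - x \<in> M"
  using M_scale[of "- 1" x] by (simp add: scale_minus_left)

lemma M_diff [intro, simp]: "x \<in> M \<Longrightarrow> z \<in> M \<Longrightarrow> x - z \<in> M"
  using M_add[of x "- z"] by simp

lemma M_0 [intro, simp]: "0 \<in> M"
  using M_diff[of 1 1] by simp

lemma J_uminus [intro, simp]: "x \<in> J \<Longrightarrow> - x \<in> J"
  using J_scale[of "- 1" x] by (simp add: scale_minus_left)

lemma J_diff [intro, simp]: "x \<in> J \<Longrightarrow> z \<in> J \<Longrightarrow> x - z \<in> J"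
  using J_add[of x "- z"] by simp

definition eqv :: "'r \<Rightarrow> 'r \<Rightarrow> bool"  (infix "\<approx>" 50)
  where "x \<approx> z \<longleftrightarrow> x - z \<in> J"

lemma eqvI: "x - z \<in> J \<Longrightarrow> x \<approx> z"
  by (simp add: eqv_def)

lemma eqv_refl [intro, simp]: "x \<approx> x"
  by (simp add: eqv_def)

lemma eqv_sym: "x \<approx> z \<Longrightarrow> z \<approx> x"
  using J_uminus[of "x - z"] by (simp add: eqv_def)

lemma eqv_trans [trans]: "x \<approx> z \<Longrightarrow> z \<approx> t \<Longrightarrow> x \<approx> t"
  using J_add[of "x - z" "z - t"] by (simp add: eqv_def)

lemma eqv_add: "x \<approx> x' \<Longrightarrow> z \<approx> z' \<Longrightarrow> x + z \<approx> x' + z'"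
  using J_add[of "x - x'" "z - z'"] by (simp add: eqv_def algebra_simps)

lemma eqv_diff: "x \<approx> x' \<Longrightarrow> z \<approx> z' \<Longrightarrow> x - z \<approx> x' - z'"
  using J_diff[of "x - x'" "z - z'"] by (simp add: eqv_def algebra_simps)

lemma eqv_scale: "x \<approx> x' \<Longrightarrow> c \<in> B \<Longrightarrow> c *s x \<approx> c *s x'"
  using J_scale[of c "x - x'"] by (simp add: eqv_def scale_right_diff_distrib)

lemma eqv_mult:
  assumes "x \<approx> x'" "z \<approx> z'" "x \<in> M" "z' \<in> M"
  shows "x * z \<approx> x' * z'"
proof -
  \<comment> \<open>This way of telescoping asks only \<open>x\<close> and \<open>z'\<close> to lie
    in \<open>M\<close>; it explains the shape of the side conditions in later congruence
    rules.\<close>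
  have "x * z - x' * z' = x * (z - z') + (x - x') * z'"
    by (simp add: algebra_simps)
  with assms show ?thesis
    by (auto simp: eqv_def)
qed

lemma eqv_J [trans]: "x \<approx> z \<Longrightarrow> z \<in> J \<Longrightarrow> x \<in> J"
  using J_add[of "x - z" z] by (simp add: eqv_def)

section \<open>Elements commuting with \<open>e\<close> modulo \<open>J\<close>, the quadratic Serre
  relation, and q-commutators\<close>

definition cent :: "'r \<Rightarrow> 'r set"
  where "cent e = {x \<in> M. x * e \<approx> e * x}"

lemma cent_M: "x \<in> cent e \<Longrightarrow> x \<in> M"
  by (simp add: cent_def)

lemma cent_J: "x \<in> cent e \<Longrightarrow> x * e - e * x \<in> J"
  by (simp add: cent_def eqv_def)

lemma centI: "x \<in> M \<Longrightarrow> x * e - e * x \<in> J \<Longrightarrow> x \<in> cent e"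
  by (simp add: cent_def eqv_def)

lemma cent_1: "1 \<in> cent e" and cent_0: "0 \<in> cent e"
  by (simp_all add: cent_def)

lemma cent_diff: "x \<in> cent e \<Longrightarrow> z \<in> cent e \<Longrightarrow> x - z \<in> cent e"
  by (auto simp: cent_def algebra_simps intro: eqv_diff)

lemma cent_scale: "c \<in> B \<Longrightarrow> x \<in> cent e \<Longrightarrow> c *s x \<in> cent e"
  by (auto simp: cent_def intro: eqv_scale)

lemma cent_mult:
  assumes "x \<in> cent e" "z \<in> cent e" "e \<in> M"
  shows "x * z \<in> cent e"
proof (rule centI)
  have "x * z * e - e * (x * z) = x * (z * e - e * z) + (x * e - e * x) * z"
    by (simp add: algebra_simps)
  then show "x * z * e - e * (x * z) \<in> J"
    using assms by (simp add: cent_M cent_J)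
qed (use assms in \<open>simp add: cent_M\<close>)

text \<open>\<open>t\<close> plays the role of \<open>[2]\<^sub>q\<close>.\<close>

definition serre_elem :: "'k \<Rightarrow> 'r \<Rightarrow> 'r \<Rightarrow> 'r"
  where "serre_elem t e x = e * e * x + x * e * e - t *s (e * x * e)"

definition serre_set :: "'k \<Rightarrow> 'r \<Rightarrow> 'r set"
  where "serre_set t e = {x \<in> M. serre_elem t e x \<in> J}"

lemma serre_set_M: "x \<in> serre_set t e \<Longrightarrow> x \<in> M"
  by (simp add: serre_set_def)

lemma serre_set_J: "x \<in> serre_set t e \<Longrightarrow> serre_elem t e x \<in> J"
  by (simp add: serre_set_def)

lemma serre_set_diff: "x \<in> serre_set t e \<Longrightarrow> z \<in> serre_set t e \<Longrightarrow> x - z \<in> serre_set t e"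
proof -
  have "serre_elem t e (x - z) = serre_elem t e x - serre_elem t e z"
    by (simp add: serre_elem_def algebra_simps)
  then show "x \<in> serre_set t e \<Longrightarrow> z \<in> serre_set t e \<Longrightarrow> x - z \<in> serre_set t e"
    by (simp add: serre_set_def)
qed

lemma serre_set_scale: "c \<in> B \<Longrightarrow> x \<in> serre_set t e \<Longrightarrow> c *s x \<in> serre_set t e"
proof -
  have "serre_elem t e (c *s x) = c *s serre_elem t e x"
    by (simp add: serre_elem_def algebra_simps)
  then show "c \<in> B \<Longrightarrow> x \<in> serre_set t e \<Longrightarrow> c *s x \<in> serre_set t e"
    by (simp add: serre_set_def)
qed

text \<open>Modulo \<open>J\<close>, the map \<open>serre_elem t e\<close> is linear over the
  centralizer of \<open>e\<close>: moving \<open>g\<close> past \<open>e\<close> costs only terms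
  containing the commutator \<open>?c\<close>, which lies in \<open>J\<close>.\<close>

lemma serre_set_mult_left:
  assumes "g \<in> cent e" "x \<in> serre_set t e" "e \<in> M" "t \<in> B"
  shows "g * x \<in> serre_set t e"
proof -
  let ?c = "g * e - e * g"
  have eq: "serre_elem t e (g * x) =
      g * serre_elem t e x - e * ?c * x - ?c * e * x + t *s (?c * x * e)"
    by (simp add: serre_elem_def algebra_simps)
  have "serre_elem t e (g * x) \<in> J"
    unfolding eq using assms cent_J[OF assms(1)] serre_set_J[OF assms(2)]
    by (simp add: cent_M serre_set_M)
  then show ?thesis
    using assms by (simp add: serre_set_def cent_M)
qed

lemma serre_set_mult_right:
  assumes "g \<in> cent e" "x \<in> serre_set t e" "e \<in> M" "t \<in> B"
  shows "x * g \<in> serre_set t e"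
proof -
  let ?c = "g * e - e * g"
  have eq: "serre_elem t e (x * g) =
      serre_elem t e x * g + x * ?c * e + x * e * ?c - t *s (e * x * ?c)"
    by (simp add: serre_elem_def algebra_simps)
  have "serre_elem t e (x * g) \<in> J"
    unfolding eq using assms cent_J[OF assms(1)] serre_set_J[OF assms(2)]
    by (simp add: cent_M serre_set_M)
  then show ?thesis
    using assms by (simp add: serre_set_def cent_M)
qed

text \<open>The bracket \<open>[x,y]_a\<close> from the definition of the \<open>f_ij\<close>; the
  abstract counterpart of \<open>qcomm\<close>.\<close>

definition br :: "'r \<Rightarrow> 'r \<Rightarrow> 'k \<Rightarrow> 'r"
  where "br x z c = x * z - c *s (z * x)"

lemma br_M [intro, simp]: "x \<in> M \<Longrightarrow> z \<in> M \<Longrightarrow> c \<in> B \<Longrightarrow> br x z c \<in> M"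
  by (simp add: br_def)

lemma br_cent: "x \<in> cent e \<Longrightarrow> z \<in> cent e \<Longrightarrow> c \<in> B \<Longrightarrow> e \<in> M \<Longrightarrow> br x z c \<in> cent e"
  by (simp add: br_def cent_diff cent_mult cent_scale)

lemma br_serre_set_left:
  "g \<in> cent e \<Longrightarrow> x \<in> serre_set t e \<Longrightarrow> c \<in> B \<Longrightarrow> e \<in> M \<Longrightarrow> t \<in> B \<Longrightarrow> br g x c \<in> serre_set t e"
  by (simp add: br_def serre_set_diff serre_set_scale serre_set_mult_left serre_set_mult_right)

lemma br_serre_set_right:
  "g \<in> cent e \<Longrightarrow> x \<in> serre_set t e \<Longrightarrow> c \<in> B \<Longrightarrow> e \<in> M \<Longrightarrow> t \<in> B \<Longrightarrow> br x g c \<in> serre_set t e"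
  by (simp add: br_def serre_set_diff serre_set_scale serre_set_mult_left serre_set_mult_right)

lemma br_cong:
  "x \<approx> x' \<Longrightarrow> z \<approx> z' \<Longrightarrow> x \<in> M \<Longrightarrow> x' \<in> M \<Longrightarrow> z \<in> M \<Longrightarrow> z' \<in> M \<Longrightarrow> c \<in> B
    \<Longrightarrow> br x z c \<approx> br x' z' c"
  unfolding br_def by (intro eqv_diff eqv_scale eqv_mult)

text \<open>A q-Jacobi identity: when \<open>g\<close> commutes with \<open>e\<close>, bracketing
  with \<open>g\<close> on the left and with \<open>e\<close> on the right are commuting operations
  on \<open>u\<close>. It pulls a generator from the inside of a nested bracket to the outside;
  \<open>br_right_nest\<close> is the mirror image.\<close>

lemma br_left_nest:
  assumes "g \<in> cent e" "u \<in> M" "e \<in> M" "b \<in> B" "c \<in> B"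
  shows "br g (br u e b) c \<approx> br (br g u c) e b"
proof (rule eqvI)
  define d where "d = g * e - e * g"
  have eq: "br g (br u e b) c - br (br g u c) e b = - (b *s (d * u)) - c *s (u * - d)"
    by (simp add: d_def br_def algebra_simps)
  show "br g (br u e b) c - br (br g u c) e b \<in> J"
    unfolding eq using assms cent_J[OF assms(1)] by (simp flip: d_def)
qed

lemma br_right_nest:
  assumes "g \<in> cent e" "u \<in> M" "e \<in> M" "b \<in> B" "c \<in> B"
  shows "br (br e u b) g c \<approx> br e (br u g c) b"
proof (rule eqvI)
  define d where "d = g * e - e * g"
  have eq: "br (br e u b) g c - br e (br u g c) b = b *s (u * d) - c *s (d * u)"
    by (simp add: d_def br_def algebra_simps)
  show "br (br e u b) g c - br e (br u g c) b \<in> J"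
    unfolding eq using assms cent_J[OF assms(1)] by (simp flip: d_def)
qed

end

subsection \<open>Weighted path sums\<close>

context cong_algebra
begin

text \<open>
  \<open>jump a f h ls g\<close> is the sum of \<open>g(m\<^sub>1) f(m\<^sub>1,m\<^sub>2) \<cdots> h(m\<^sub>k)\<close> over the nonempty subsequences
  \<open>m\<close> of \<open>ls\<close>, weighted with \<open>a l\<close> for every \<open>l\<close> that is left out.
\<close>

primrec jump :: "(nat \<Rightarrow> 'k) \<Rightarrow> (nat \<Rightarrow> nat \<Rightarrow> 'r) \<Rightarrow> (nat \<Rightarrow> 'r) \<Rightarrow> nat list \<Rightarrow> (nat \<Rightarrow> 'r) \<Rightarrow> 'r"
  where
  "jump a f h [] g = 0"
| "jump a f h (l # ls) g =
    a l *s jump a f h ls g + g l * (prod_list (map a ls) *s h l + jump a f h ls (f l))"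

text \<open>Each element of \<open>ls\<close> is either skipped, with weight \<open>a l\<close>, or
  visited. With \<open>a l\<close> the inverse of \<open>A l j\<close> this becomes
  \<open>fcheck i j\<close>.\<close>

primrec paths :: "(nat \<Rightarrow> 'k) \<Rightarrow> (nat \<Rightarrow> nat \<Rightarrow> 'r) \<Rightarrow> nat \<Rightarrow> nat list \<Rightarrow> nat \<Rightarrow> 'r"
  where
  "paths a f i [] j = f i j"
| "paths a f i (l # ls) j = a l *s paths a f i ls j + f i l * paths a f l ls j"

lemma paths_eq_jump:
  "paths a f i ls j = prod_list (map a ls) *s f i j + jump a f (\<lambda>m. f m j) ls (f i)"
  by (induction ls arbitrary: i) (simp_all add: algebra_simps)

text \<open>A path either skips \<open>t\<close> or passes through it, and in the second case its
  two halves are chosen independently.\<close>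

lemma paths_append:
  "paths a f i (ls @ t # ks) j = a t *s paths a f i (ls @ ks) j + paths a f i ls t * paths a f t ks j"
  by (induction ls arbitrary: i) (simp_all add: algebra_simps)

lemma paths_M:
  assumes "\<And>l m. f l m \<in> M" "\<And>l. l \<in> set ls \<Longrightarrow> a l \<in> B"
  shows "paths a f i ls j \<in> M"
  using assms by (induction ls arbitrary: i) auto

lemma jump_M:
  assumes "\<And>l m. f l m \<in> M" "\<And>l. l \<in> set ls \<Longrightarrow> a l \<in> B"
    and "\<And>l. l \<in> set ls \<Longrightarrow> g l \<in> M" "\<And>l. l \<in> set ls \<Longrightarrow> h l \<in> M"
  shows "jump a f h ls g \<in> M"
  using assms
proof (induction ls arbitrary: g)
  case (Cons l ls)
  then show ?case
    by (auto intro!: M_add M_scale M_mult B_prod_list)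
qed auto

lemma jump_row_mult: "jump a f h ls (\<lambda>k. x * g k) = x * jump a f h ls g"
  by (induction ls) (simp_all add: algebra_simps)

lemma jump_row_scale: "jump a f h ls (\<lambda>k. c *s g k) = c *s jump a f h ls g"
  by (induction ls) (simp_all add: algebra_simps)

lemma jump_row_add: "jump a f h ls (\<lambda>k. g k + g' k) = jump a f h ls g + jump a f h ls g'"
  by (induction ls) (simp_all add: algebra_simps)

lemma jump_row_diff: "jump a f h ls (\<lambda>k. g k - g' k) = jump a f h ls g - jump a f h ls g'"
  using jump_row_add[of a f h ls "\<lambda>k. g k - g' k" g'] by simp

lemma jump_col_mult: "jump a f (\<lambda>m. h m * x) ls g = jump a f h ls g * x"
  by (induction ls arbitrary: g) (simp_all add: algebra_simps)

lemma jump_col_scale: "jump a f (\<lambda>m. c *s h m) ls g = c *s jump a f h ls g"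
  by (induction ls arbitrary: g) (simp_all add: algebra_simps)

lemma jump_col_add:
  "jump a f (\<lambda>m. h m + h' m) ls g = jump a f h ls g + jump a f h' ls g"
  by (induction ls arbitrary: g) (simp_all add: algebra_simps)

lemma jump_col_diff:
  "jump a f (\<lambda>m. h m - h' m) ls g = jump a f h ls g - jump a f h' ls g"
  using jump_col_add[of a f "\<lambda>m. h m - h' m" h' ls g] by simp

lemmas jump_linear = jump_row_mult jump_row_scale jump_row_diff jump_row_add
  jump_col_mult jump_col_scale jump_col_diff jump_col_add

lemma jump_cong:
  assumes "\<And>l m. f l m \<in> M" "\<And>l. l \<in> set ls \<Longrightarrow> a l \<in> B"
    and "\<And>l. l \<in> set ls \<Longrightarrow> g l \<in> M" "\<And>l. l \<in> set ls \<Longrightarrow> h' l \<in> M"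
    and "\<And>l. l \<in> set ls \<Longrightarrow> g l \<approx> g' l" "\<And>l. l \<in> set ls \<Longrightarrow> h l \<approx> h' l"
  shows "jump a f h ls g \<approx> jump a f h' ls g'"
  using assms
proof (induction ls arbitrary: g g')
  case (Cons l ls)
  have p: "prod_list (map a ls) \<in> B"
    using Cons.prems by (auto intro!: B_prod_list)
  have "jump a f h ls g \<approx> jump a f h' ls g'"
    using Cons.prems by (intro Cons.IH) auto
  moreover have "jump a f h ls (f l) \<approx> jump a f h' ls (f l)"
    using Cons.prems by (intro Cons.IH) auto
  ultimately show ?case
    using Cons.prems p by (auto intro!: eqv_add eqv_scale eqv_mult M_add M_scale jump_M)
qed auto

text \<open>All factors strictly inside a path commute with \<open>e\<close>, so an \<open>e\<close>
  in front of the last factor can travel to the place right behind the first one.\<close>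

lemma jump_commute:
  assumes "\<And>l m. f l m \<in> M" "\<And>l. l \<in> set ls \<Longrightarrow> a l \<in> B" "e \<in> M"
    and "\<And>l. l \<in> set ls \<Longrightarrow> g l \<in> M" "\<And>l. l \<in> set ls \<Longrightarrow> h l \<in> M"
    and "\<And>l m. l \<in> set ls \<Longrightarrow> m \<in> set ls \<Longrightarrow> f l m \<in> cent e"
  shows "jump a f (\<lambda>m. e * h m) ls g \<approx> jump a f h ls (\<lambda>k. g k * e)"
  using assms
proof (induction ls arbitrary: g)
  case (Cons l ls)
  have p: "prod_list (map a ls) \<in> B"
    using Cons.prems by (auto intro!: B_prod_list)
  have 1: "jump a f (\<lambda>m. e * h m) ls g \<approx> jump a f h ls (\<lambda>k. g k * e)"
    using Cons.prems by (intro Cons.IH) auto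
  \<comment> \<open>In the tail sum the first factor comes from the row \<open>f l\<close> and is
    itself an inner factor of the whole path, so \<open>e\<close> passes it as well and stops right
    behind \<open>g l\<close>.\<close>
  have "jump a f (\<lambda>m. e * h m) ls (f l) \<approx> jump a f h ls (\<lambda>k. f l k * e)"
    using Cons.prems by (intro Cons.IH) auto
  also have "\<dots> \<approx> jump a f h ls (\<lambda>k. e * f l k)"
    using Cons.prems by (intro jump_cong) (auto simp: cent_def)
  also have "\<dots> = e * jump a f h ls (f l)"
    by (rule jump_row_mult)
  finally have 2: "jump a f (\<lambda>m. e * h m) ls (f l) \<approx> e * jump a f h ls (f l)" .
  have 3: "g l * (prod_list (map a ls) *s (e * h l) + jump a f (\<lambda>m. e * h m) ls (f l))
      \<approx> g l * (prod_list (map a ls) *s (e * h l) + e * jump a f h ls (f l))"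
    using Cons.prems 2 p by (auto intro!: eqv_add eqv_mult M_add M_scale M_mult jump_M)
  have "a l *s jump a f (\<lambda>m. e * h m) ls g
      + g l * (prod_list (map a ls) *s (e * h l) + jump a f (\<lambda>m. e * h m) ls (f l))
    \<approx> a l *s jump a f h ls (\<lambda>k. g k * e)
      + g l * (prod_list (map a ls) *s (e * h l) + e * jump a f h ls (f l))"
    using Cons.prems by (intro eqv_add eqv_scale 1 3) auto
  then show ?case
    by (simp add: algebra_simps)
qed auto

end

section \<open>The inductive step for path sums\<close>

text \<open>\<open>r\<close> is the inverse of \<open>[2]_q = q + qb\<close>; dividing by it lets
  the Serre relations determine commutators with \<open>e\<close>.\<close>

locale q_cong_algebra = cong_algebra +
  fixes q qb r :: 'a
  assumes q_inverse: "q * qb = 1" "r * (q + qb) = 1"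
    and q_B [simp]: "q \<in> B" "qb \<in> B" "r \<in> B"
begin

lemma q_inverse' [simp]: "qb * q = 1" "q * qb = 1" "q * (qb * c) = c" "qb * (q * c) = c"
  using q_inverse(1) mult.assoc[of q qb c] mult.assoc[of qb q c] mult.commute[of q qb] by simp_all

abbreviation "serre \<equiv> serre_elem (q + qb)"

text \<open>
  Here \<open>e = f\<^sub>a\<close>, \<open>u = f\<^bsub>a+1,c\<^esub>\<close> and \<open>v = f\<^bsub>c,(a+1)'\<^esub>\<close> with \<open>c\<close> in the middle of the poset, and
  \<open>P, Q, R, T\<close> are the four elements \<open>f\<^sub>x\<^sub>z\<close> with \<open>x \<in> {a, a+1}\<close> and \<open>z \<in> {a', (a+1)'}\<close>.
\<close>

lemma corner_relations:
  assumes "e \<in> M" "u \<in> M" "v \<in> M" "\<kappa> \<in> B"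
    and "serre e u \<in> J" "serre e v \<in> J"
  defines "u' \<equiv> br u e qb" and "v' \<equiv> br e v qb"
  defines "T \<equiv> q *s (v * u) - \<kappa> *s (u * v)" and "P \<equiv> v * u' - \<kappa> *s (u' * v)"
    and "Q \<equiv> v' * u - \<kappa> *s (u * v')" and "R \<equiv> q *s (v' * u') - \<kappa> *s (u' * v')"
  shows "P * e - e * Q \<approx> r *s (T * e * e - e * e * T)"
    and "R \<approx> q *s (P * e) - qb *s (e * Q) - T * e * e + e * T * e"
proof -
  \<comment> \<open>After multiplication by \<open>q + qb\<close> the difference is a combination of
    Serre elements times \<open>u\<close> or \<open>v\<close>; \<open>r\<close> removes the
    multiplier afterwards.\<close>
  have "(q + qb) *s (P * e - e * Q) - (T * e * e - e * e * T) =
      qb *s (v * serre e u) - qb *s (serre e v * u) + \<kappa> *s (u * serre e v) - \<kappa> *s (serre e u * v)"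
    by (simp add: u'_def v'_def T_def P_def Q_def br_def serre_elem_def algebra_simps)
  also have "\<dots> \<in> J"
    using assms(1-6) by auto
  finally have "r *s ((q + qb) *s (P * e - e * Q) - (T * e * e - e * e * T)) \<in> J"
    by auto
  moreover have "r *s ((q + qb) *s (P * e - e * Q) - (T * e * e - e * e * T))
      = P * e - e * Q - r *s (T * e * e - e * e * T)"
    using q_inverse(2) by (simp add: scale_right_diff_distrib)
  ultimately show "P * e - e * Q \<approx> r *s (T * e * e - e * e * T)"
    by (simp add: eqv_def)
  have "R - (q *s (P * e) - qb *s (e * Q) - T * e * e + e * T * e) =
      qb *s (serre e v * u) - \<kappa> *s (u * serre e v)"
    by (simp add: u'_def v'_def T_def P_def Q_def R_def br_def serre_elem_def algebra_simps)
  also have "\<dots> \<in> J"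
    using assms(1-6) by auto
  finally show "R \<approx> q *s (P * e) - qb *s (e * Q) - T * e * e + e * T * e"
    by (simp add: eqv_def)
qed

text \<open>\<open>?S\<close> is the path sum at \<open>a\<close>, written through \<open>W\<close>
  and the sum \<open>Z\<close> with an extra \<open>e\<close>; \<open>\<alpha>\<close> and
  \<open>\<alpha>'\<close> are the weights of the two outermost stops. It turns out to be a
  combination of multiples of \<open>\<gamma>\<close>, of the commutator defect \<open>V\<close>, of
  the error \<open>H\<close> in \<open>R\<close> and of the inner path sum
  \<open>K'\<close>.\<close>

lemma paths_combination:
  assumes "e \<in> M" "P \<in> M" "Q \<in> M" "T \<in> M" "Z \<in> M" "W \<in> M"
    and "p \<in> B" "\<alpha> \<in> B" "\<alpha>' \<in> B"
    and PQ: "P * e - e * Q \<approx> r *s (T * e * e - e * e * T)"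
    and R: "R \<approx> q *s (P * e) - qb *s (e * Q) - T * e * e + e * T * e"
    and Z: "e * Z - Z * e \<approx> r *s (e * e * W - W * e * e)"
    and K: "p *s T + W \<in> J"
    and \<Gamma>: "\<And>x. x \<in> M \<Longrightarrow> (\<alpha> + \<alpha>' + (q - qb) * \<alpha> * \<alpha>') *s x \<in> J"
  shows "(\<alpha> * \<alpha>') *s (p *s R + (q *s (Z * e) - W * e * e - qb *s (e * Z) + (qb * qb) *s (e * W * e)))
      + \<alpha> *s ((p *s P + (Z - qb *s (e * W))) * e)
      + \<alpha>' *s (e * (p *s Q + (Z - qb *s (W * e))))
      + e * (p *s T + W) * e \<in> J" (is "?S \<in> J")
proof -
  define D where "D = P * e - e * Q - r *s (T * e * e - e * e * T)"
  define H where "H = R - (q *s (P * e) - qb *s (e * Q) - T * e * e + e * T * e)"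
  define E where "E = e * Z - Z * e - r *s (e * e * W - W * e * e)"
  define K' where "K' = p *s T + W"
  define \<gamma> where "\<gamma> = \<alpha> + \<alpha>' + (q - qb) * \<alpha> * \<alpha>'"
  \<comment> \<open>The coefficient of \<open>\<alpha>'\<close> in \<open>?S\<close>. That of
    \<open>\<alpha>\<close> is \<open>x + V\<close>, and that of \<open>\<alpha> * \<alpha>'\<close>
    is \<open>(q - qb) *s x\<close> up to terms in \<open>J\<close>, which is exactly the pattern of
    \<open>\<gamma>\<close>.\<close>
  define x where "x = p *s (e * Q) + e * Z - qb *s (e * W * e)"
  \<comment> \<open>The commutator of \<open>e\<close> with the \<open>P\<close>, \<open>Q\<close>
    part and with \<open>Z\<close> involves \<open>T\<close> and \<open>W\<close> in the same way,
    so the two contributions join to terms containing \<open>K'\<close>.\<close>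
  define V where "V = p *s D - E - r *s (e * e * K') + r *s (K' * e * e)"
  have J: "D \<in> J" "H \<in> J" "E \<in> J" "K' \<in> J"
    using PQ R Z K by (simp_all add: D_def H_def E_def K'_def eqv_def)
  have V: "V = p *s (P * e) + Z * e - p *s (e * Q) - e * Z"
    by (simp add: V_def D_def E_def K'_def algebra_simps)
  have \<alpha>': "\<alpha>' = \<gamma> - \<alpha> - (q - qb) * \<alpha> * \<alpha>'"
    by (simp add: \<gamma>_def)
  have "?S = \<gamma> *s x + \<alpha> *s V
      + (\<alpha> * \<alpha>') *s (p *s H + q *s V - K' * e * e + e * K' * e) + e * K' * e"
    by (simp add: V \<gamma>_def x_def H_def K'_def algebra_simps)
  also have "\<dots> \<in> J"
  proof -
    have "x \<in> M"
      using assms(1-9) by (auto simp: x_def)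
    then have "\<gamma> *s x \<in> J"
      unfolding \<gamma>_def by (rule \<Gamma>)
    moreover have "V \<in> J"
      unfolding V_def using assms(1-9) J by (intro J_add J_diff J_scale J_mult_left J_mult_right M_mult) auto
    ultimately show ?thesis
      using assms(1,7-9) J(2,4) by simp
  qed
  finally show ?thesis .
qed

text \<open>Here \<open>i\<close>, \<open>b\<close>, \<open>b'\<close>, \<open>i'\<close> play the
  roles of \<open>a\<close>, \<open>a + 1\<close> and their mirror images in reverse order. Visiting
  or skipping \<open>b\<close> and \<open>b'\<close> gives four sums over \<open>ls\<close>;
  \<open>row\<close> and \<open>col\<close> rewrite each of them through sums that leave from
  \<open>b\<close> and arrive at \<open>b'\<close>.\<close>

lemma paths_step:
  assumes f_M: "\<And>l m. f l m \<in> M"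
    and a_B: "\<And>l. l \<in> set ls \<union> {b, b'} \<Longrightarrow> a l \<in> B"
    and e: "f i b = e" "f b' i' = e"
    and row: "\<And>k. k \<in> set ls \<Longrightarrow> f i k \<approx> br (f b k) e qb"
    and col: "\<And>m. m \<in> set ls \<Longrightarrow> f m i' \<approx> br e (f m b') qb"
    and row_serre: "\<And>k. k \<in> set ls \<Longrightarrow> serre e (f b k) \<in> J"
    and col_serre: "\<And>m. m \<in> set ls \<Longrightarrow> serre e (f m b') \<in> J"
    and cent: "\<And>l m. l \<in> set ls \<Longrightarrow> m \<in> set ls \<Longrightarrow> f l m \<in> cent e"
    and PQ: "f i b' * e - e * f b i' \<approx> r *s (f b b' * e * e - e * e * f b b')"
    and R: "f i i' \<approx> q *s (f i b' * e) - qb *s (e * f b i') - f b b' * e * e + e * f b b' * e"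
    and inner: "paths a f b ls b' \<in> J"
    and \<Gamma>: "\<And>x. x \<in> M \<Longrightarrow> (a b + a b' + (q - qb) * a b * a b') *s x \<in> J"
  shows "paths a f i (b # ls @ [b']) i' \<in> J"
proof -
  have eM: "e \<in> M"
    using f_M e(1) by auto
  \<comment> \<open>The weight picked up by skipping all of \<open>ls\<close>.\<close>
  define p where "p = prod_list (map a ls)"
  have p: "p \<in> B"
    unfolding p_def using a_B by (auto intro!: B_prod_list)
  define u where "u = f b"
  define v where "v = (\<lambda>m. f m b')"
  define v' where "v' = (\<lambda>m. f m i')"
  define X where "X = (\<lambda>g h. jump a f h ls g)"
  have uM [simp]: "u k \<in> M" and vM [simp]: "v k \<in> M" and v'M [simp]: "v' k \<in> M" for k
    using f_M by (simp_all add: u_def v_def v'_def)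
  have X_M: "X g h \<in> M" if "\<And>k. g k \<in> M" "\<And>k. h k \<in> M" for g h
    unfolding X_def using that f_M a_B by (intro jump_M) auto
  have X_cong: "X g h \<approx> X g' h'"
    if "\<And>k. g k \<in> M" "\<And>k. h' k \<in> M" "\<And>k. k \<in> set ls \<Longrightarrow> g k \<approx> g' k"
      "\<And>k. k \<in> set ls \<Longrightarrow> h k \<approx> h' k" for g g' h h'
    unfolding X_def using that f_M a_B by (intro jump_cong) auto
  have X_commute: "X g (\<lambda>m. e * h m) \<approx> X (\<lambda>k. g k * e) h"
    if "\<And>k. g k \<in> M" "\<And>k. h k \<in> M" for g h
    unfolding X_def using that f_M a_B eM cent by (intro jump_commute) auto
  have X_linear:
    "X (\<lambda>k. x * g k) h = x * X g h" "X (\<lambda>k. c *s g k) h = c *s X g h"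
    "X (\<lambda>k. g k - g' k) h = X g h - X g' h" "X (\<lambda>k. g k + g' k) h = X g h + X g' h"
    "X g (\<lambda>k. h k * x) = X g h * x" "X g (\<lambda>k. c *s h k) = c *s X g h"
    "X g (\<lambda>k. h k - h' k) = X g h - X g h'" "X g (\<lambda>k. h k + h' k) = X g h + X g h'"
    for x c g g' h h'
    unfolding X_def by (rule jump_linear)+
  define W where "W = X u v"
  define Z where "Z = X u (\<lambda>m. e * v m)"
  have WM: "W \<in> M" and ZM: "Z \<in> M"
    unfolding W_def Z_def using eM by (auto intro!: X_M)
  have Z': "Z \<approx> X (\<lambda>k. u k * e) v"
    unfolding Z_def by (rule X_commute) auto
  have Xuv': "X u v' \<approx> Z - qb *s (W * e)"
  proof -
    have "X u v' \<approx> X u (\<lambda>m. br e (v m) qb)"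
      using col eM f_M by (intro X_cong) (auto simp: v_def v'_def)
    then show ?thesis
      by (simp add: br_def X_linear W_def Z_def)
  qed
  have row_split: "X (f i) h \<approx> X (\<lambda>k. u k * e) h - qb *s (e * X u h)"
    if "\<And>k. h k \<in> M" for h
  proof -
    have "X (f i) h \<approx> X (\<lambda>k. br (u k) e qb) h"
      using row eM f_M that by (intro X_cong) (auto simp: u_def)
    then show ?thesis
      by (simp add: br_def X_linear)
  qed
  have Xu'v: "X (f i) v \<approx> Z - qb *s (e * W)"
  proof -
    have "X (f i) v \<approx> X (\<lambda>k. u k * e) v - qb *s (e * W)"
      unfolding W_def by (rule row_split) auto
    also have "\<dots> \<approx> Z - qb *s (e * W)"
      by (intro eqv_diff eqv_sym[OF Z']) auto
    finally show ?thesis .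
  qed
  have Xu'v': "X (f i) v' \<approx> q *s (Z * e) - W * e * e - qb *s (e * Z) + (qb * qb) *s (e * W * e)"
  proof -
    \<comment> \<open>\<open>e\<close> is carried to the last factor \<open>v' m\<close>, a bracket
      of \<open>e\<close> and \<open>v m\<close>. The Serre relation says precisely that
      \<open>e\<close> q-commutes with this bracket, so \<open>e\<close> can leave the sum on the
      right.\<close>
    have "X (\<lambda>k. u k * e) v' \<approx> X u (\<lambda>m. e * v' m)"
      by (rule eqv_sym[OF X_commute]) auto
    also have "\<dots> \<approx> X u (\<lambda>m. q *s (v' m * e))"
    proof (rule X_cong)
      fix m assume m: "m \<in> set ls"
      have v': "v' m \<approx> br e (v m) qb"
        using col[OF m] by (simp add: v_def v'_def)
      have "e * v' m \<approx> e * br e (v m) qb"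
        using v' eM by (intro eqv_mult) auto
      also have "\<dots> \<approx> q *s (br e (v m) qb * e)"
        using col_serre[OF m] by (intro eqvI) (simp add: v_def br_def serre_elem_def algebra_simps)
      also have "\<dots> \<approx> q *s (v' m * e)"
        using v' eM by (intro eqv_scale eqv_mult) (auto intro: eqv_sym)
      finally show "e * v' m \<approx> q *s (v' m * e)" .
    qed (use eM in auto)
    also have "\<dots> = q *s (X u v' * e)"
      by (simp add: X_linear)
    also have "\<dots> \<approx> q *s ((Z - qb *s (W * e)) * e)"
      using Xuv' eM by (intro eqv_scale eqv_mult X_M) auto
    finally have 1: "X (\<lambda>k. u k * e) v' \<approx> q *s ((Z - qb *s (W * e)) * e)" .
    have "X (f i) v' \<approx> X (\<lambda>k. u k * e) v' - qb *s (e * X u v')"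
      by (rule row_split) auto
    also have "\<dots> \<approx> q *s ((Z - qb *s (W * e)) * e) - qb *s (e * (Z - qb *s (W * e)))"
      using Xuv' eM WM ZM by (intro eqv_diff eqv_scale 1 eqv_mult) auto
    finally show ?thesis
      by (simp add: algebra_simps)
  qed
  \<comment> \<open>\<open>[2]_q\<close> times \<open>e * Z\<close> is expanded by the Serre
    relation for the first factors, \<open>[2]_q\<close> times \<open>Z * e\<close> by the one for
    the last factors. Both expansions contain the same sum with two inserted \<open>e\<close>, which
    cancels in the commutator.\<close>
  have EZ: "e * Z - Z * e \<approx> r *s (e * e * W - W * e * e)"
  proof -
    have serre_v: "X u (\<lambda>m. (q + qb) *s (e * v m * e)) \<approx> X u (\<lambda>m. e * (e * v m) + v m * e * e)"
      using col_serre eM f_M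
      by (intro eqv_sym[OF X_cong]) (auto simp: v_def eqv_def serre_elem_def algebra_simps)
    have serre_u: "X (\<lambda>k. (q + qb) *s (e * u k * e)) v \<approx> X (\<lambda>k. e * e * u k + u k * e * e) v"
      using row_serre eM f_M
      by (intro eqv_sym[OF X_cong]) (auto simp: u_def eqv_def serre_elem_def algebra_simps)
    have "X u (\<lambda>m. e * (e * v m)) \<approx> X (\<lambda>k. u k * e) (\<lambda>m. e * v m)"
      using eM by (intro X_commute) auto
    also have "\<dots> \<approx> X (\<lambda>k. u k * e * e) v"
      using eM by (intro X_commute) auto
    finally have uee: "X u (\<lambda>m. e * (e * v m)) \<approx> X (\<lambda>k. u k * e * e) v" .
    have "(q + qb) *s (e * Z) \<approx> (q + qb) *s (e * X (\<lambda>k. u k * e) v)"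
      using eM by (intro eqv_scale eqv_mult Z' X_M) auto
    also have "\<dots> = X (\<lambda>k. (q + qb) *s (e * u k * e)) v"
      by (simp add: X_linear mult.assoc)
    also have "\<dots> \<approx> e * e * W + X (\<lambda>k. u k * e * e) v"
      using serre_u by (simp add: X_linear W_def)
    finally have 1: "(q + qb) *s (e * Z) \<approx> e * e * W + X (\<lambda>k. u k * e * e) v" .
    have "(q + qb) *s (Z * e) = X u (\<lambda>m. (q + qb) *s (e * v m * e))"
      by (simp add: X_linear Z_def)
    also have "\<dots> \<approx> X u (\<lambda>m. e * (e * v m)) + W * e * e"
      using serre_v by (simp add: X_linear W_def)
    also have "\<dots> \<approx> X (\<lambda>k. u k * e * e) v + W * e * e"
      by (intro eqv_add uee) auto
    finally have 2: "(q + qb) *s (Z * e) \<approx> X (\<lambda>k. u k * e * e) v + W * e * e" .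
    have "r *s ((q + qb) *s (e * Z) - (q + qb) *s (Z * e)) \<approx>
        r *s ((e * e * W + X (\<lambda>k. u k * e * e) v) - (X (\<lambda>k. u k * e * e) v + W * e * e))"
      by (intro eqv_scale eqv_diff 1 2) auto
    moreover have "r *s ((q + qb) *s (e * Z) - (q + qb) *s (Z * e)) = e * Z - Z * e"
      using q_inverse(2) by (simp add: scale_right_diff_distrib)
    ultimately show ?thesis
      by simp
  qed
  have inner': "p *s f b b' + W \<in> J"
    using inner by (simp add: paths_eq_jump p_def W_def X_def u_def v_def)
  \<comment> \<open>One summand for each choice of visiting or skipping \<open>b\<close> and
    \<open>b'\<close>; visiting both leaves the inner path sum between two copies of
    \<open>e\<close>.\<close>
  have split: "paths a f i (b # ls @ [b']) i' =
      (a b * a b') *s (p *s f i i' + X (f i) v')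
      + a b *s ((p *s f i b' + X (f i) v) * e)
      + a b' *s (e * (p *s f b i' + X u v')) + e * (p *s f b b' + W) * e"
    using paths_append[of a f _ ls b' "[]"]
    by (simp add: paths_eq_jump p_def W_def X_def u_def v_def v'_def e algebra_simps)
  have "paths a f i (b # ls @ [b']) i' \<approx>
      (a b * a b') *s (p *s f i i'
        + (q *s (Z * e) - W * e * e - qb *s (e * Z) + (qb * qb) *s (e * W * e)))
      + a b *s ((p *s f i b' + (Z - qb *s (e * W))) * e)
      + a b' *s (e * (p *s f b i' + (Z - qb *s (W * e)))) + e * (p *s f b b' + W) * e"
    unfolding split using eM WM ZM f_M p a_B
    by (intro eqv_add eqv_scale eqv_mult Xu'v' Xu'v Xuv' eqv_refl) (auto intro!: X_M M_add)
  also have "\<dots> \<in> J"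
    by (rule paths_combination[OF eM f_M f_M f_M ZM WM p _ _ PQ R EZ inner' \<Gamma>]) (use a_B in auto)
  finally show ?thesis .
qed

end

section \<open>Path sums as sums over subsequences\<close>

context cong_algebra
begin

primrec route_prod :: "(nat \<Rightarrow> nat \<Rightarrow> 'r) \<Rightarrow> nat \<Rightarrow> nat list \<Rightarrow> nat \<Rightarrow> 'r" where
  "route_prod f i [] j = f i j"
| "route_prod f i (m # ms) j = f i m * route_prod f m ms j"

lemma set_subseqs_subset: "m \<in> set (subseqs ls) \<Longrightarrow> set m \<subseteq> set ls"
  using subseqs_powset[of ls] by blast

lemma paths_eq_sum:
  assumes "distinct ls"
  shows "paths a f i ls j =
    (\<Sum>m\<in>set (subseqs ls). prod a (set ls - set m) *s route_prod f i m j)"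
  using assms
proof (induction ls arbitrary: i)
  case (Cons l ls)
  let ?S = "set (subseqs ls)"
  have sub: "set m \<subseteq> set ls" if "m \<in> ?S" for m
    using that by (rule set_subseqs_subset)
  have split: "set (subseqs (l # ls)) = Cons l ` ?S \<union> ?S"
    by (simp add: Let_def)
  have "(\<Sum>m\<in>set (subseqs (l # ls)). prod a (set (l # ls) - set m) *s route_prod f i m j)
      = (\<Sum>m\<in>Cons l ` ?S. prod a (set (l # ls) - set m) *s route_prod f i m j)
      + (\<Sum>m\<in>?S. prod a (set (l # ls) - set m) *s route_prod f i m j)"
    unfolding split using Cons.prems by (intro sum.union_disjoint) (auto dest: set_subseqs_subset)
  also have "(\<Sum>m\<in>Cons l ` ?S. prod a (set (l # ls) - set m) *s route_prod f i m j)
      = (\<Sum>m\<in>?S. f i l * (prod a (set ls - set m) *s route_prod f l m j))"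
  proof (subst sum.reindex, simp, intro sum.cong refl)
    fix m assume "m \<in> ?S"
    have "set (l # ls) - set (l # m) = set ls - set m"
      using Cons.prems by auto
    then show "((\<lambda>m. prod a (set (l # ls) - set m) *s route_prod f i m j) \<circ> Cons l) m
        = f i l * (prod a (set ls - set m) *s route_prod f l m j)"
      by simp
  qed
  also have "\<dots> = f i l * paths a f l ls j"
    using Cons by (simp add: sum_distrib_left)
  also have "(\<Sum>m\<in>?S. prod a (set (l # ls) - set m) *s route_prod f i m j)
      = (\<Sum>m\<in>?S. a l *s (prod a (set ls - set m) *s route_prod f i m j))"
  proof (intro sum.cong refl)
    fix m assume "m \<in> ?S"
    then have "set (l # ls) - set m = insert l (set ls - set m)"
      using Cons.prems sub by auto
    then show "prod a (set (l # ls) - set m) *s route_prod f i m j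
        = a l *s (prod a (set ls - set m) *s route_prod f i m j)"
      using Cons.prems by simp
  qed
  also have "\<dots> = a l *s paths a f i ls j"
    using Cons by (simp add: scale_sum_right)
  finally show ?case
    by (simp add: add.commute)
qed simp

end

text \<open>A strictly increasing list is determined by its set of entries. This is how the routes
  in \<open>fhat\<close> are recognised among the subsequences of an interval.\<close>

lemma set_subseqs_sorted:
  assumes "sorted_wrt (<) (ls :: nat list)"
  shows "set (subseqs ls) = {m. sorted_wrt (<) m \<and> set m \<subseteq> set ls}"
  using assms
proof (induction ls)
  case (Cons l ls)
  have "m \<in> Cons l ` {m. sorted_wrt (<) m \<and> set m \<subseteq> set ls} \<union> {m. sorted_wrt (<) m \<and> set m \<subseteq> set ls}
      \<longleftrightarrow> sorted_wrt (<) m \<and> set m \<subseteq> set (l # ls)" for m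
  proof (cases m)
    case (Cons x xs)
    have "set xs \<subseteq> insert l (set ls) \<longleftrightarrow> set xs \<subseteq> set ls"
      if "sorted_wrt (<) (x # xs)" "x \<in> insert l (set ls)"
    proof -
      have "l \<notin> set xs"
        using that Cons.prems by fastforce
      then show ?thesis
        by blast
    qed
    with Cons Cons.prems show ?thesis
      by (auto simp: image_iff)
  qed auto
  with Cons show ?case
    by (auto simp: Let_def)
qed auto

context q_cong_algebra
begin

text \<open>The recursions for \<open>f_ij\<close> hold only modulo the Serre relations, so the
  corner relations are needed for elements that are merely congruent to the two brackets.\<close>

lemma corner_relations_cong:
  assumes "e \<in> M" "u \<in> M" "v \<in> M" "ua \<in> M" "va \<in> M" "\<kappa> \<in> B"
    and "serre e u \<in> J" "serre e v \<in> J"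
    and ua: "ua \<approx> br u e qb" and va: "va \<approx> br e v qb"
  defines "T \<equiv> q *s (v * u) - \<kappa> *s (u * v)" and "P \<equiv> v * ua - \<kappa> *s (ua * v)"
    and "Q \<equiv> va * u - \<kappa> *s (u * va)" and "R \<equiv> q *s (va * ua) - \<kappa> *s (ua * va)"
  shows "P * e - e * Q \<approx> r *s (T * e * e - e * e * T)"
    and "R \<approx> q *s (P * e) - qb *s (e * Q) - T * e * e + e * T * e"
proof -
  let ?u = "br u e qb" and ?v = "br e v qb"
  let ?P = "v * ?u - \<kappa> *s (?u * v)" and ?Q = "?v * u - \<kappa> *s (u * ?v)"
    and ?R = "q *s (?v * ?u) - \<kappa> *s (?u * ?v)"
  have P: "P \<approx> ?P" and Q: "Q \<approx> ?Q" and R: "R \<approx> ?R"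
    unfolding P_def Q_def R_def using assms(1-10)
    by (auto intro!: eqv_diff eqv_scale eqv_mult)
  have M: "P \<in> M" "Q \<in> M" "?P \<in> M" "?Q \<in> M" "T \<in> M"
    using assms(1-6) by (auto simp: P_def Q_def T_def)
  note rel = corner_relations[OF assms(1-3,6-8), folded T_def]
  have Pe: "P * e \<approx> ?P * e" and eQ: "e * Q \<approx> e * ?Q"
    using P Q M assms(1) by (auto intro!: eqv_mult)
  have "P * e - e * Q \<approx> ?P * e - e * ?Q"
    by (intro eqv_diff Pe eQ)
  also note rel(1)
  finally show "P * e - e * Q \<approx> r *s (T * e * e - e * e * T)" .
  note R
  also note rel(2)
  also have "q *s (?P * e) - qb *s (e * ?Q) - T * e * e + e * T * e
      \<approx> q *s (P * e) - qb *s (e * Q) - T * e * e + e * T * e"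
    using Pe eQ by (intro eqv_add eqv_diff eqv_scale) (auto intro: eqv_sym)
  finally show "R \<approx> q *s (P * e) - qb *s (e * Q) - T * e * e + e * T * e" .
qed

end

subsection \<open>The free algebra over a field\<close>

definition smul :: "'k::comm_ring_1 \<Rightarrow> 'k freealg \<Rightarrow> 'k freealg"
  where "smul c x = scal c * x"

lemma freealg_induct [case_names zero single add]:
  assumes "P 0" "\<And>w c. P (Poly_Mapping.single w c)" "\<And>x z. P x \<Longrightarrow> P z \<Longrightarrow> P (x + z)"
  shows "P (x :: 'k::ab_group_add freealg)"
proof (induction x rule: update_induct)
  case (update x w c)
  then have "Poly_Mapping.update w c x = x + Poly_Mapping.single w c"
    by (intro poly_mapping_eqI) (auto simp: lookup_update lookup_add lookup_single in_keys_iff when_def)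
  with assms update show ?case
    by simp
qed (use assms in auto)

lemma scal_central: "scal c * x = x * scal (c :: 'k::comm_ring_1)"
  by (induction x rule: freealg_induct)
    (simp_all add: distrib_left distrib_right mult_single mult.commute)

lemma lookup_smul: "Poly_Mapping.lookup (smul c x) w = c * Poly_Mapping.lookup x w"
proof -
  have "Poly_Mapping.map ((*) c) x = smul c x"
    by (simp add: smul_def mult_map_scale_conv_mult)
  then have "Poly_Mapping.lookup (smul c x) w = Poly_Mapping.lookup (Poly_Mapping.map ((*) c) x) w"
    by simp
  then show ?thesis
    by (simp add: map.rep_eq when_def)
qed

lemma smul_mult_left: "smul c x * z = smul c (x * z)"
  by (simp add: smul_def mult.assoc)

lemma smul_mult_right: "x * smul c z = smul c (x * z)"
  by (simp add: smul_def scal_central[of c] mult.assoc flip: scal_central[of c "x * z"])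

lemma smul_smul: "smul c (smul d x) = smul (c * d) x"
  by (simp add: smul_def mult_single flip: mult.assoc)

lemma module_smul: "module smul"
  by standard (simp_all add: smul_smul, simp_all add: smul_def algebra_simps single_add)

lemma hconst_0 [simp]: "hconst 0 = 0" and hconst_1 [simp]: "hconst 1 = 1"
  and hconst_add: "hconst (c + d) = hconst c + hconst d"
  and hconst_uminus: "hconst (- c) = - hconst c"
  and hconst_mult: "hconst (c * d) = hconst c * hconst d"
  by (simp_all add: hconst_def Zero_fract_def One_fract_def single_add mult_single single_uminus)

lemma hconst_diff: "hconst (c - d) = hconst c - hconst d"
  using hconst_add[of c "- d"] by (simp add: hconst_uminus)

lemma hconst_eq_0 [simp]: "hconst c = 0 \<longleftrightarrow> c = 0"
proof -
  have "(Poly_Mapping.single 0 c :: weight \<Rightarrow>\<^sub>0 complex) = 0 \<longleftrightarrow> c = 0"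
    by (metis lookup_single_eq lookup_zero single_zero)
  then show ?thesis
    by (simp add: hconst_def Zero_fract_def eq_fract)
qed

lemma lookup_tens: "Poly_Mapping.lookup (tens x a) w = hconst (Poly_Mapping.lookup x w) * a"
  by (simp add: tens_def map.rep_eq when_def)

lemma tens_eq_smul: "tens x a = smul a (tens x 1)"
  by (intro poly_mapping_eqI) (simp add: lookup_tens lookup_smul)

abbreviation ext :: "complex freealg \<Rightarrow> hfield freealg"
  where "ext x \<equiv> tens x 1"

lemma ext_0 [simp]: "ext 0 = 0"
  and ext_add: "ext (x + z) = ext x + ext z"
  and ext_diff: "ext (x - z) = ext x - ext z"
  by (intro poly_mapping_eqI; simp add: lookup_tens lookup_add lookup_minus hconst_add hconst_diff)+

lemma ext_single: "ext (Poly_Mapping.single w c) = Poly_Mapping.single w (hconst c)"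
  by (intro poly_mapping_eqI) (auto simp: lookup_tens lookup_single when_def)

lemma ext_1 [simp]: "ext 1 = 1"
  using ext_single[of 0 1] by simp

lemma ext_mult: "ext (x * z) = ext x * ext z"
proof (induction x rule: freealg_induct)
  case (single w c)
  show ?case
    by (induction z rule: freealg_induct)
      (simp_all add: ext_single ext_add distrib_left mult_single hconst_mult)
qed (simp_all add: ext_add distrib_right)

lemma ext_scal_mult: "ext (scal c * x) = smul (hconst c) (ext x)"
  by (simp add: ext_mult ext_single smul_def)

lemma letters_add: "letters (v + w) = letters v @ letters w"
  by (simp add: plus_fword_def)

lemma letters_0 [simp]: "letters 0 = []"
  by (simp add: zero_fword_def)

lemma carrier_free_ring:
  "x \<in> carrier (free_ring m) \<longleftrightarrow> (\<forall>w\<in>Poly_Mapping.keys x. set (letters w) \<subseteq> {1..m})"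
  by (simp add: free_ring_def)

lemma free_ring_simps:
  "x \<otimes>\<^bsub>free_ring m\<^esub> z = x * z" "x \<oplus>\<^bsub>free_ring m\<^esub> z = x + z"
  "\<one>\<^bsub>free_ring m\<^esub> = 1" "\<zero>\<^bsub>free_ring m\<^esub> = 0"
  by (simp_all add: free_ring_def)

lemma free_ring_closed:
  shows "0 \<in> carrier (free_ring m)" "1 \<in> carrier (free_ring m)" "scal c \<in> carrier (free_ring m)"
    and "x \<in> carrier (free_ring m) \<Longrightarrow> - x \<in> carrier (free_ring m)"
    and "x \<in> carrier (free_ring m) \<Longrightarrow> z \<in> carrier (free_ring m) \<Longrightarrow> x + z \<in> carrier (free_ring m)"
    and "x \<in> carrier (free_ring m) \<Longrightarrow> z \<in> carrier (free_ring m) \<Longrightarrow> x * z \<in> carrier (free_ring m)"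
proof -
  show "x \<in> carrier (free_ring m) \<Longrightarrow> - x \<in> carrier (free_ring m)"
    by (simp add: carrier_free_ring in_keys_iff)
  show "x \<in> carrier (free_ring m) \<Longrightarrow> z \<in> carrier (free_ring m) \<Longrightarrow> x + z \<in> carrier (free_ring m)"
    using keys_add[of x z] by (auto simp: carrier_free_ring)
  show "x \<in> carrier (free_ring m) \<Longrightarrow> z \<in> carrier (free_ring m) \<Longrightarrow> x * z \<in> carrier (free_ring m)"
    using keys_mult[of x z] by (fastforce simp: carrier_free_ring letters_add)
qed (auto simp: carrier_free_ring)

lemma ring_free_ring: "ring (free_ring m)"
proof (rule ringI)
  show "abelian_group (free_ring m)"
  proof (rule abelian_groupI)
    fix x assume "x \<in> carrier (free_ring m)"
    then have "- x \<in> carrier (free_ring m)" "- x \<oplus>\<^bsub>free_ring m\<^esub> x = \<zero>\<^bsub>free_ring m\<^esub>"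
      by (simp_all add: free_ring_closed free_ring_simps)
    then show "\<exists>z\<in>carrier (free_ring m). z \<oplus>\<^bsub>free_ring m\<^esub> x = \<zero>\<^bsub>free_ring m\<^esub>"
      by blast
  qed (auto simp: free_ring_simps free_ring_closed algebra_simps)
  show "monoid (free_ring m)"
    by (rule monoidI) (auto simp: free_ring_simps free_ring_closed algebra_simps)
qed (auto simp: free_ring_simps algebra_simps)

lemma free_ring_minus:
  assumes "x \<in> carrier (free_ring m)" "z \<in> carrier (free_ring m)"
  shows "x \<ominus>\<^bsub>free_ring m\<^esub> z = x - z"
proof -
  interpret ring "free_ring m"
    by (rule ring_free_ring)
  have "\<ominus>\<^bsub>free_ring m\<^esub> z = - z"
    using assms by (intro minus_equality) (auto simp: free_ring_simps free_ring_closed)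
  then show ?thesis
    by (simp add: a_minus_def free_ring_simps)
qed

lemma ext_carrier:
  "x \<in> carrier (free_ring m) \<Longrightarrow> ext x \<in> carrier (free_ring m)"
  by (auto simp: carrier_free_ring in_keys_iff lookup_tens)

subsection \<open>Congruences modulo the Serre relations and \<open>\<delta>\<^sub>j\<^sup>-\<close>\<close>

text \<open>The column \<open>j\<close> is fixed because \<open>alg_A j\<close> and
  \<open>delta_minus j\<close> depend on it. The value \<open>N = 4\<close> is left out since so(4)
  is not simple.\<close>

locale so_column = quantum_so +
  fixes j :: nat
  assumes N_ge: "N \<ge> 3" and N_neq: "N \<noteq> 4"
    and q_generic: "\<And>k. k \<ge> 1 \<Longrightarrow> q ^ k \<noteq> 1"
    and j_le: "1 \<le> j" "j \<le> N"
begin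

lemma q_nonzero: "q \<noteq> 0"
  by (simp add: q_def qpow_def)

lemma q_qbar [simp]: "q * qbar = 1" "qbar * q = 1"
  by (simp_all add: qbar_def q_nonzero)

lemma q_plus_qbar: "q + qbar \<noteq> 0"
proof
  assume "q + qbar = 0"
  then have "q * (q + qbar) = 0"
    by simp
  then have "q ^ 2 = - 1"
    by (simp add: distrib_left power2_eq_square eq_neg_iff_add_eq_0)
  then have "(q ^ 2) ^ 2 = 1"
    by simp
  with q_generic[of 4] show False
    by simp
qed

lemma q_minus_qbar: "q - qbar \<noteq> 0"
proof
  assume "q - qbar = 0"
  then have "q * (q - qbar) = 0"
    by simp
  then have "q ^ 2 = 1"
    by (simp add: right_diff_distrib power2_eq_square)
  with q_generic[of 2] show False
    by simp
qed

lemma q_plus_1: "q + 1 \<noteq> 0"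
proof
  assume "q + 1 = 0"
  then have "q = - 1"
    by (simp add: eq_neg_iff_add_eq_0)
  with q_generic[of 2] show False
    by simp
qed

lemma rank_pos: "1 \<le> n" "even N \<Longrightarrow> 3 \<le> n"
  using N_ge N_neq by (auto simp: n_def elim!: evenE)

lemma N_eq: "odd N \<Longrightarrow> N = 2 * n + 1" "even N \<Longrightarrow> N = 2 * n"
  by (auto simp: n_def)

text \<open>Representatives in the free algebra of the elements of
  \<open>Uq_tensor (alg_A j)\<close>. Divisibility by \<open>delta_minus j\<close> in the quotient
  then becomes membership in \<open>div_ideal\<close>.\<close>

definition int_alg :: "hfield freealg set"
  where "int_alg = {x \<in> carrier (free_ring n). \<forall>w. Poly_Mapping.lookup x w \<in> alg_A j}"

text \<open>Not contained in \<open>int_alg\<close>: the elements of \<open>serreK\<close> have arbitrary coefficients in \<open>hfield\<close>.\<close>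

definition div_ideal :: "hfield freealg set"
  where "div_ideal = {smul (delta_minus j) m + t |m t. m \<in> int_alg \<and> t \<in> serreK}"

lemma free_ring_sum_closed:
  "(\<And>k. k \<in> K \<Longrightarrow> x k \<in> carrier (free_ring n)) \<Longrightarrow> sum x K \<in> carrier (free_ring n)"
  by (induction K rule: infinite_finite_induct) (auto simp: free_ring_closed)

lemma free_ring_power_closed: "x \<in> carrier (free_ring n) \<Longrightarrow> x ^ k \<in> carrier (free_ring n)"
  by (induction k) (auto simp: free_ring_closed)

lemma gen_carrier: "l \<in> {1..n} \<Longrightarrow> gen l \<in> carrier (free_ring n)"
  by (auto simp: carrier_free_ring)

lemma serre_carrier: "l \<in> {1..n} \<Longrightarrow> m \<in> {1..n} \<Longrightarrow> serre l m \<in> carrier (free_ring n)"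
  unfolding serre_def Let_def
  by (intro free_ring_sum_closed free_ring_closed(6) free_ring_power_closed free_ring_closed(3) gen_carrier)

lemma ideal_serreK: "ideal serreK (free_ring n)"
  unfolding serreK_def
  by (intro ring.genideal_ideal ring_free_ring) (auto simp: serre_rels_def intro!: ext_carrier serre_carrier)

lemma serreK_closed:
  shows "0 \<in> serreK"
    and "x \<in> serreK \<Longrightarrow> z \<in> serreK \<Longrightarrow> x + z \<in> serreK"
    and "x \<in> carrier (free_ring n) \<Longrightarrow> z \<in> serreK \<Longrightarrow> x * z \<in> serreK"
    and "x \<in> serreK \<Longrightarrow> z \<in> carrier (free_ring n) \<Longrightarrow> x * z \<in> serreK"
proof -
  interpret ideal serreK "free_ring n"
    by (rule ideal_serreK)
  show "0 \<in> serreK"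
    using additive_subgroup.zero_closed[OF ideal.axioms(1)[OF ideal_serreK]] by (simp add: free_ring_simps)
  show "x \<in> serreK \<Longrightarrow> z \<in> serreK \<Longrightarrow> x + z \<in> serreK"
    using additive_subgroup.a_closed[OF ideal.axioms(1)[OF ideal_serreK]] by (simp add: free_ring_simps)
  show "x \<in> carrier (free_ring n) \<Longrightarrow> z \<in> serreK \<Longrightarrow> x * z \<in> serreK"
    using I_l_closed by (simp add: free_ring_simps)
  show "x \<in> serreK \<Longrightarrow> z \<in> carrier (free_ring n) \<Longrightarrow> x * z \<in> serreK"
    using I_r_closed by (simp add: free_ring_simps)
qed

lemma ext_serre_mem: "l \<in> {1..n} \<Longrightarrow> m \<in> {1..n} \<Longrightarrow> l \<noteq> m \<Longrightarrow> ext (serre l m) \<in> serreK"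
proof -
  assume lm: "l \<in> {1..n}" "m \<in> {1..n}" "l \<noteq> m"
  have "ext ` serre_rels \<subseteq> serreK"
    unfolding serreK_def
    by (intro ring.genideal_self ring_free_ring) (auto simp: serre_rels_def intro!: ext_carrier serre_carrier)
  with lm show ?thesis
    by (auto simp: serre_rels_def)
qed

lemma alg_A_0: "0 \<in> alg_A j"
  using alg_A.intros(1)[of 0 j] by simp

lemma alg_A_1: "1 \<in> alg_A j"
  using alg_A.intros(1)[of 1 j] by simp

lemma alg_A_uminus: "c \<in> alg_A j \<Longrightarrow> - c \<in> alg_A j"
  using alg_A.intros(5)[OF alg_A.intros(1)[of "- 1"], of c] by (simp add: hconst_uminus)

lemma alg_A_sum: "(\<And>k. k \<in> K \<Longrightarrow> x k \<in> alg_A j) \<Longrightarrow> sum x K \<in> alg_A j"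
  by (induction K rule: infinite_finite_induct) (auto intro: alg_A_0 alg_A.intros(4))

lemma int_alg_mult:
  assumes "x \<in> int_alg" "z \<in> int_alg"
  shows "x * z \<in> int_alg"
proof -
  have "Poly_Mapping.lookup (x * z) w \<in> alg_A j" for w
    unfolding lookup_mult Sum_any.expand_set using assms
    by (intro alg_A_sum alg_A.intros(5)) (auto simp: int_alg_def when_def intro: alg_A_0)
  with assms show ?thesis
    by (simp add: int_alg_def free_ring_closed)
qed

lemma int_alg_add: "x \<in> int_alg \<Longrightarrow> z \<in> int_alg \<Longrightarrow> x + z \<in> int_alg"
  by (simp add: int_alg_def free_ring_closed lookup_add alg_A.intros(4))

lemma int_alg_smul: "c \<in> alg_A j \<Longrightarrow> x \<in> int_alg \<Longrightarrow> smul c x \<in> int_alg"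
  by (simp add: int_alg_def lookup_smul alg_A.intros(5)) (simp add: smul_def free_ring_closed)

lemma int_alg_1: "1 \<in> int_alg"
  by (auto simp: int_alg_def free_ring_closed lookup_one when_def alg_A_0 alg_A_1)

lemma int_alg_0: "0 \<in> int_alg"
  by (auto simp: int_alg_def free_ring_closed alg_A_0)

lemma int_alg_carrier: "x \<in> int_alg \<Longrightarrow> x \<in> carrier (free_ring n)"
  by (simp add: int_alg_def)

lemma div_idealI: "m \<in> int_alg \<Longrightarrow> t \<in> serreK \<Longrightarrow> smul (delta_minus j) m + t \<in> div_ideal"
  by (auto simp: div_ideal_def)

lemma serreK_div_ideal: "t \<in> serreK \<Longrightarrow> t \<in> div_ideal"
  using div_idealI[OF int_alg_0] by (simp add: smul_def)

lemma delta_div_ideal: "m \<in> int_alg \<Longrightarrow> smul (delta_minus j) m \<in> div_ideal"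
  using div_idealI[OF _ serreK_closed(1)] by simp

text \<open>Congruence now means: modulo the Serre relations and modulo \<open>delta_minus j\<close>
  times \<open>int_alg\<close>. The inverse of \<open>[2]_q\<close> exists because
  \<open>q ^ 4 \<noteq> 1\<close>.\<close>

sublocale cong: q_cong_algebra smul "alg_A j" int_alg div_ideal
  "hconst q" "hconst qbar" "hconst (1 / (q + qbar))"
proof -
  interpret module smul
    by (rule module_smul)
  show "q_cong_algebra smul (alg_A j) int_alg div_ideal
      (hconst q) (hconst qbar) (hconst (1 / (q + qbar)))"
  proof
    show "0 \<in> div_ideal"
      using serreK_div_ideal serreK_closed(1) by blast
  next
    fix x z assume "x \<in> div_ideal" "z \<in> div_ideal"
    then obtain m t m' t' where "m \<in> int_alg" "t \<in> serreK" "m' \<in> int_alg" "t' \<in> serreK"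
      and x: "x = smul (delta_minus j) m + t" "z = smul (delta_minus j) m' + t'"
      by (auto simp: div_ideal_def)
    then have "smul (delta_minus j) (m + m') + (t + t') \<in> div_ideal"
      by (intro div_idealI int_alg_add serreK_closed)
    then show "x + z \<in> div_ideal"
      by (simp add: x scale_right_distrib algebra_simps)
  next
    fix c x assume c: "c \<in> alg_A j" and "x \<in> div_ideal"
    then obtain m t where "m \<in> int_alg" "t \<in> serreK" and x: "x = smul (delta_minus j) m + t"
      by (auto simp: div_ideal_def)
    with c have "smul (delta_minus j) (smul c m) + scal c * t \<in> div_ideal"
      by (intro div_idealI int_alg_smul serreK_closed free_ring_closed)
    then show "smul c x \<in> div_ideal"
      by (simp add: x scale_right_distrib mult.commute) (simp add: smul_def)
  next
    fix x z assume M: "x \<in> int_alg" and "z \<in> div_ideal"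
    then obtain m t where "m \<in> int_alg" "t \<in> serreK" and z: "z = smul (delta_minus j) m + t"
      by (auto simp: div_ideal_def)
    with M have "smul (delta_minus j) (x * m) + x * t \<in> div_ideal"
      by (intro div_idealI int_alg_mult serreK_closed int_alg_carrier)
    then show "x * z \<in> div_ideal"
      by (simp add: z distrib_left smul_mult_right)
  next
    fix x z assume "x \<in> div_ideal" and M: "z \<in> int_alg"
    then obtain m t where "m \<in> int_alg" "t \<in> serreK" and x: "x = smul (delta_minus j) m + t"
      by (auto simp: div_ideal_def)
    with M have "smul (delta_minus j) (m * z) + t * z \<in> div_ideal"
      by (intro div_idealI int_alg_mult serreK_closed int_alg_carrier)
    then show "x * z \<in> div_ideal"
      by (simp add: x distrib_right smul_mult_left)
  next
    show "hconst q * hconst qbar = 1" "hconst (1 / (q + qbar)) * (hconst q + hconst qbar) = 1"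
      using q_plus_qbar by (simp_all flip: hconst_mult hconst_add)
  qed (auto intro: alg_A.intros alg_A_uminus alg_A_1 int_alg_add int_alg_mult int_alg_smul int_alg_1
      simp: smul_mult_left smul_mult_right)
qed

section \<open>Inner products of weights and Cartan integers\<close>

lemma ip_add: "ip (\<mu> + \<nu>) \<xi> = ip \<mu> \<xi> + ip \<nu> \<xi>" "ip \<xi> (\<mu> + \<nu>) = ip \<xi> \<mu> + ip \<xi> \<nu>"
  by (simp_all add: ip_def lookup_add algebra_simps sum.distrib)

lemma ip_diff: "ip (\<mu> - \<nu>) \<xi> = ip \<mu> \<xi> - ip \<nu> \<xi>" "ip \<xi> (\<mu> - \<nu>) = ip \<xi> \<mu> - ip \<xi> \<nu>"
  by (simp_all add: ip_def lookup_minus algebra_simps sum_subtractf)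

lemma ip_uminus: "ip (- \<mu>) \<xi> = - ip \<mu> \<xi>" "ip \<xi> (- \<mu>) = - ip \<xi> \<mu>"
  by (simp_all add: ip_def sum_negf)

lemma ip_0: "ip 0 \<xi> = 0" "ip \<xi> 0 = 0"
  by (simp_all add: ip_def)

lemma ip_single:
  assumes "i \<in> {1..n}"
  shows "ip (Poly_Mapping.single i 1) (Poly_Mapping.single k 1) = (if i = k then 1 else 0)"
proof -
  have "ip (Poly_Mapping.single i 1) (Poly_Mapping.single k 1)
      = (\<Sum>l\<in>{1..n}. if l = i then (if i = k then 1 else 0) else 0)"
    unfolding ip_def by (intro sum.cong) (auto simp: lookup_single when_def)
  with assms show ?thesis
    by simp
qed

lemma eps_lo: "i \<le> n \<Longrightarrow> eps i = Poly_Mapping.single i 1"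
  using N_eq by (cases "odd N") (auto simp: eps_def)

lemma ip_eps: "i \<in> {1..n} \<Longrightarrow> k \<in> {1..n} \<Longrightarrow> ip (eps i) (eps k) = (if i = k then 1 else 0)"
  by (simp add: eps_lo ip_single)

lemma cartan_long:
  assumes "1 \<le> l" "l < n"
  shows "cartan l m = ip (simple_root l) (simple_root m)" "qroot l = q"
proof -
  have "ip (simple_root l) (simple_root l) = 2"
    using assms by (simp add: simple_root_def ip_diff ip_eps)
  then show "cartan l m = ip (simple_root l) (simple_root m)" "qroot l = q"
    by (simp_all add: cartan_def qroot_def q_def)
qed

section \<open>Commutation and Serre relations between the generators\<close>

abbreviation G :: "nat \<Rightarrow> hfield freealg"
  where "G l \<equiv> ext (gen l)"

lemma G_int_alg [simp]: "1 \<le> l \<Longrightarrow> l \<le> n \<Longrightarrow> G l \<in> int_alg"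
  unfolding int_alg_def
  by (auto simp: gen_carrier intro!: ext_carrier) (auto simp: lookup_tens alg_A.intros)

lemma qint_1: "qint q 1 = 1"
  using q_minus_qbar by (simp add: qint_def qbar_def)

lemma qint_2: "qint q 2 = q + qbar"
proof -
  have "q ^ 2 - qbar ^ 2 = (q + qbar) * (q - qbar)"
    by (simp add: power2_eq_square algebra_simps)
  then show ?thesis
    using q_minus_qbar by (simp add: qint_def flip: qbar_def)
qed

lemma qfact: "qfact q 0 = 1" "qfact q 1 = 1" "qfact q 2 = q + qbar"
  using qint_1 qint_2 by (simp_all add: qfact_def numeral_2_eq_2)

lemma ext_serre_0:
  assumes "1 \<le> l" "l < n" "cartan l m = 0"
  shows "ext (serre l m) = G l * G m - G m * G l"
proof -
  have "serre l m = gen l * gen m - gen m * gen l"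
    using assms(3) qfact cartan_long(2)[OF assms(1,2)]
    by (simp add: serre_def qbinom_def single_uminus)
  then show ?thesis
    by (simp only: ext_diff ext_mult)
qed

lemma ext_serre_1:
  assumes "1 \<le> l" "l < n" "cartan l m = - 1"
  shows "ext (serre l m) = cong.serre (G l) (G m)"
proof -
  have "serre l m = gen l * gen l * gen m - scal (q + qbar) * (gen l * gen m * gen l) + gen m * gen l * gen l"
    using assms(3) qfact cartan_long(2)[OF assms(1,2)] q_plus_qbar
    by (simp add: serre_def qbinom_def single_uminus single_add single_diff numeral_2_eq_2 algebra_simps)
  then have "ext (serre l m) = ext (gen l * gen l * gen m)
      - ext (scal (q + qbar) * (gen l * gen m * gen l)) + ext (gen m * gen l * gen l)"
    by (simp only: ext_add ext_diff)
  then show ?thesis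
    unfolding ext_scal_mult unfolding ext_mult hconst_add cong.serre_elem_def by simp
qed

text \<open>Nodes not joined in the Dynkin diagram commute. The excluded case is the fork of type D,
  where node \<open>n\<close> is joined to node \<open>n - 2\<close>.\<close>

lemma G_cent:
  assumes "1 \<le> a" "a + 2 \<le> m" "m \<le> n" "\<not> (even N \<and> m = n \<and> a + 2 = n)"
  shows "G m \<in> cong.cent (G a)"
proof -
  have "cartan a m = 0"
    using assms by (auto simp: cartan_long simple_root_def ip_diff ip_add ip_eps)
  then have "G a * G m - G m * G a \<in> div_ideal"
    using assms ext_serre_mem[of a m] by (auto simp: ext_serre_0 intro: serreK_div_ideal)
  then have "- (G a * G m - G m * G a) \<in> div_ideal"
    by (rule cong.J_uminus)
  with assms show ?thesis
    by (intro cong.centI) auto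
qed

text \<open>The two tips of the fork are not joined.\<close>

lemma G_last_cent:
  assumes "even N"
  shows "G n \<in> cong.cent (G (n - 1))"
proof -
  have n: "3 \<le> n"
    using rank_pos assms by auto
  then have "cartan (n - 1) n = 0"
    using assms by (auto simp: cartan_long simple_root_def ip_diff ip_add ip_eps)
  then have "G (n - 1) * G n - G n * G (n - 1) \<in> div_ideal"
    using n ext_serre_mem[of "n - 1" n] by (auto simp: ext_serre_0 intro: serreK_div_ideal)
  then have "- (G (n - 1) * G n - G n * G (n - 1)) \<in> div_ideal"
    by (rule cong.J_uminus)
  with n show ?thesis
    by (intro cong.centI) auto
qed

abbreviation "serre_set \<equiv> cong.serre_set (hconst q + hconst qbar)"

text \<open>The relation is quadratic in \<open>G a\<close> even when \<open>a + 1 = n\<close> is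
  the short root of type B: the long root \<open>a\<close> stands first in the Cartan integer, which
  is therefore -1. For even \<open>N\<close> the nodes \<open>n - 1\<close> and \<open>n\<close> are
  not joined, whence the last hypothesis.\<close>

lemma G_serre_set:
  assumes "1 \<le> a" "a + 1 \<le> n" "odd N \<or> a + 1 < n"
  shows "G (a + 1) \<in> serre_set (G a)"
proof -
  have "cartan a (a + 1) = - 1"
    using assms by (auto simp: cartan_long simple_root_def ip_diff ip_add ip_eps)
  then show ?thesis
    using assms ext_serre_mem[of a "a + 1"]
    by (auto simp: ext_serre_1 cong.serre_set_def intro: serreK_div_ideal)
qed

lemma G_last_serre_set:
  assumes "even N" "a + 2 = n"
  shows "G n \<in> serre_set (G a)"
proof -
  have n: "3 \<le> n"
    using rank_pos assms by auto
  then have "cartan a n = - 1"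
    using assms by (auto simp: cartan_long simple_root_def ip_diff ip_add ip_eps)
  then show ?thesis
    using n assms ext_serre_mem[of a n]
    by (auto simp: ext_serre_1 cong.serre_set_def intro: serreK_div_ideal)
qed

end

subsection \<open>The elements \<open>f\<^sub>i\<^sub>j\<close>\<close>

context so_column
begin

lemma ext_qcomm: "ext (qcomm x z c) = cong.br (ext x) (ext z) (hconst c)"
  unfolding qcomm_def cong.br_def ext_diff mult.assoc ext_scal_mult by (simp add: ext_mult)

lemma hconst_alg_A [simp]: "hconst c \<in> alg_A j"
  by (rule alg_A.intros)

definition FL :: "nat \<Rightarrow> nat \<Rightarrow> hfield freealg" where "FL i k = ext (f_lo i k)"
definition FH :: "nat \<Rightarrow> nat \<Rightarrow> hfield freealg" where "FH i k = ext (f_hi i k)"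
definition FN :: "nat \<Rightarrow> hfield freealg" where "FN i = ext (f_from_n i)"
definition FN' :: "nat \<Rightarrow> hfield freealg" where "FN' i = ext (f_to_npr i)"

text \<open>The value 0 outside the index range puts \<open>F i k\<close> into
  \<open>int_alg\<close> for all \<open>i\<close> and \<open>k\<close>, as the rules for path sums
  require.\<close>

definition F :: "nat \<Rightarrow> nat \<Rightarrow> hfield freealg"
  where "F i k = (if 1 \<le> i \<and> k \<le> N then ext (f i k) else 0)"

lemma FL_Suc: "FL i (Suc i) = G i" "i < k \<Longrightarrow> FL i (Suc k) = cong.br (G k) (FL i k) (hconst qbar)"
  by (simp_all add: FL_def ext_qcomm)

lemma FH_Suc: "FH i (Suc i) = G i" "i < k \<Longrightarrow> FH i (Suc k) = cong.br (FH i k) (G k) (hconst qbar)"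
  by (simp_all add: FH_def ext_qcomm)

lemma FN_eq: "FN (n - 1) = G n" "i < n - 1 \<Longrightarrow> FN i = cong.br (FH i (n - 1)) (G n) (hconst qbar)"
  by (simp_all add: FN_def FH_def f_from_n_def ext_qcomm)

lemma FN'_eq: "FN' (n - 1) = G n" "i < n - 1 \<Longrightarrow> FN' i = cong.br (G n) (FL i (n - 1)) (hconst qbar)"
  by (simp_all add: FN'_def FL_def f_to_npr_def ext_qcomm)

lemma F_trivial: "1 \<le> i \<Longrightarrow> i \<le> N \<Longrightarrow> F i i = 1" "k < i \<Longrightarrow> F i k = 0"
  by (simp_all add: F_def f_def)

lemma F_lo: "1 \<le> i \<Longrightarrow> i < k \<Longrightarrow> 2 * k \<le> N + 1 \<Longrightarrow> F i k = FL i k"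
  by (simp add: F_def f_def FL_def)

lemma F_hi: "N + 1 \<le> 2 * i \<Longrightarrow> i < k \<Longrightarrow> k \<le> N \<Longrightarrow> F i k = FH (pr k) (pr i)"
  by (simp add: F_def f_def FH_def)

lemma pr_pr: "z \<le> N + 1 \<Longrightarrow> pr (pr z) = z"
  by (simp add: pr_def)

lemma F_odd:
  assumes "odd N" "1 \<le> i" "i \<le> n" "1 \<le> z" "z \<le> n"
  shows "F i (pr z) = (let d = if i = z then 1 else 0 in
    smul (hconst q ^ d) (cong.br (FH z (n + 1)) (FL i (n + 1)) (hconst qbar ^ d)))"
proof -
  have "f i (pr z) = f_odd i z"
    using assms N_eq by (auto simp: f_def pr_def)
  then have "F i (pr z) = ext (f_odd i z)"
    using assms by (auto simp: F_def pr_def)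
  then show ?thesis
    by (simp add: f_odd_def Let_def ext_qcomm ext_scal_mult FH_def FL_def flip: single_one)
qed

lemma F_even:
  assumes "even N" "1 \<le> i" "i < n" "1 \<le> z" "z < n"
  shows "F i (pr z) = (let d = if i = z then 1 else 0 in
    smul (hconst q ^ d) (cong.br (FN z) (FL i n) (hconst qbar ^ (1 + d))))"
proof -
  have "f i (pr z) = f_even i z"
    using assms N_eq by (auto simp: f_def pr_def)
  then have "F i (pr z) = ext (f_even i z)"
    using assms by (auto simp: F_def pr_def)
  then show ?thesis
    by (simp add: f_even_def Let_def ext_qcomm ext_scal_mult FN_def FL_def hconst_mult flip: single_one)
qed

lemma F_even_middle:
  assumes "even N"
  shows "F n (pr n) = 0"
    and "1 \<le> i \<Longrightarrow> i < n \<Longrightarrow> F i (pr n) = FN' i"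
    and "1 \<le> z \<Longrightarrow> z < n \<Longrightarrow> F n (pr z) = FN z"
  using assms N_eq rank_pos
  by (auto simp: F_def f_def pr_def FN_def FN'_def)

text \<open>The regions of the index square in which \<open>f\<close> is given by one formula;
  \<open>z\<close> is the mirror image of the column.\<close>

lemma F_cases:
  assumes "1 \<le> i" "i < k" "k \<le> N"
  obtains (lo) "2 * k \<le> N + 1" "F i k = FL i k"
  | (hi) "N + 1 \<le> 2 * i" "F i k = FH (pr k) (pr i)"
  | (odd) z where "odd N" "k = pr z" "1 \<le> z" "z \<le> n" "i \<le> n"
  | (middle) "even N" "i = n" "k = pr n"
  | (to_npr) "even N" "i < n" "k = pr n" "F i k = FN' i"
  | (from_n) z where "even N" "i = n" "k = pr z" "1 \<le> z" "z < n" "F i k = FN z"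
  | (even) z where "even N" "k = pr z" "1 \<le> z" "z < n" "i < n"
proof -
  consider "2 * k \<le> N + 1" | "N + 1 \<le> 2 * i" | "2 * i < N + 1" "N + 1 < 2 * k"
    by linarith
  then show thesis
  proof cases
    case 1
    with lo F_lo assms show ?thesis by blast
  next
    case 2
    with hi F_hi assms show ?thesis by blast
  next
    case 3
    then have k: "k = pr (pr k)" "1 \<le> pr k" "pr k \<le> n" "i \<le> n"
      using assms N_eq by (cases "Parity.odd N"; auto simp: pr_def)+
    show ?thesis
    proof (cases "Parity.odd N")
      case True
      with k odd show ?thesis by blast
    next
      case False
      with k middle to_npr from_n even F_even_middle(2)[of i] F_even_middle(3)[of "pr k"] assms(1)
      show ?thesis
        by (metis le_neq_implies_less)
    qed
  qed
qed

lemma FL_mem: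
  assumes "\<And>x z. x \<in> S \<Longrightarrow> z \<in> S \<Longrightarrow> cong.br x z (hconst qbar) \<in> S"
    and "i < k" "\<And>l. i \<le> l \<Longrightarrow> l < k \<Longrightarrow> G l \<in> S"
  shows "FL i k \<in> S"
  using assms(2,3)
proof (induction k)
  case (Suc k)
  then show ?case
    using assms(1) by (cases "i = k") (auto simp: FL_Suc)
qed simp

lemma FH_mem:
  assumes "\<And>x z. x \<in> S \<Longrightarrow> z \<in> S \<Longrightarrow> cong.br x z (hconst qbar) \<in> S"
    and "i < k" "\<And>l. i \<le> l \<Longrightarrow> l < k \<Longrightarrow> G l \<in> S"
  shows "FH i k \<in> S"
  using assms(2,3)
proof (induction k)
  case (Suc k)
  then show ?case
    using assms(1) by (cases "i = k") (auto simp: FH_Suc)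
qed simp

text \<open>Between \<open>lo\<close> and its mirror image, the \<open>f_ij\<close> are built by
  brackets from the generators with index at least \<open>lo\<close>. The set \<open>S\<close> is
  kept general so as to cover both \<open>int_alg\<close> and the centralizer of a
  generator.\<close>

lemma F_mem:
  assumes S: "0 \<in> S" "1 \<in> S" "\<And>c x. c \<in> alg_A j \<Longrightarrow> x \<in> S \<Longrightarrow> smul c x \<in> S"
      "\<And>c x z. c \<in> alg_A j \<Longrightarrow> x \<in> S \<Longrightarrow> z \<in> S \<Longrightarrow> cong.br x z c \<in> S"
    and G: "\<And>l. lo \<le> l \<Longrightarrow> l \<le> n \<Longrightarrow> G l \<in> S"
    and lo: "1 \<le> lo" "lo \<le> i" "k \<le> pr lo"
  shows "F i k \<in> S"
proof -
  have qA: "hconst q ^ d \<in> alg_A j" "hconst qbar ^ d \<in> alg_A j" for d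
    by (induction d) (auto intro: alg_A_1 alg_A.intros)
  have L: "FL i' k' \<in> S" if "lo \<le> i'" "i' < k'" "k' \<le> n + 1" for i' k'
    using that by (intro FL_mem S(4)) (auto intro!: G)
  have H: "FH i' k' \<in> S" if "lo \<le> i'" "i' < k'" "k' \<le> n + 1" for i' k'
    using that by (intro FH_mem S(4)) (auto intro!: G)
  have n: "FN i' \<in> S" "FN' i' \<in> S" if "lo \<le> i'" "i' < n" for i'
  proof -
    have "G n \<in> S"
      using that by (intro G) auto
    then show "FN i' \<in> S" "FN' i' \<in> S"
      using that FN_eq FN'_eq by (cases "i' = n - 1"; auto intro!: S(4) L H)+
  qed
  have k_le: "k \<le> N"
    using lo by (auto simp: pr_def)
  consider "k < i" | "k = i" | "i < k"
    by linarith
  then show ?thesis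
  proof cases
    case 3
    have "1 \<le> i"
      using lo by simp
    then show ?thesis
      using 3 k_le
    proof (cases rule: F_cases)
      case lo
      then show ?thesis
        using 3 assms(7) N_eq by (cases "odd N") (auto intro!: L)
    next
      case hi
      then show ?thesis
        using 3 assms(6-8) N_eq k_le by (cases "odd N") (auto simp: pr_def intro!: H)
    next
      case (odd z)
      then have "lo \<le> z"
        using assms(8) N_eq by (auto simp: pr_def)
      with odd lo S(3,4) qA L H show ?thesis
        using F_odd[of i z] by (auto simp: Let_def)
    next
      case middle
      then show ?thesis
        using F_even_middle S(1) by simp
    next
      case to_npr
      then show ?thesis
        using n lo by auto
    next
      case (from_n z)
      then have "lo \<le> z"
        using assms(8) N_eq by (auto simp: pr_def)
      then show ?thesis
        using from_n n by auto
    next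
      case (even z)
      then have "lo \<le> z"
        using assms(8) N_eq by (auto simp: pr_def)
      then have "FN z \<in> S" "FL i n \<in> S"
        using even lo by (auto intro!: n L)
      then show ?thesis
        using F_even[of i z] even lo S(3) S(4)[OF qA(2)] qA by (auto simp: Let_def simp del: power_Suc)
    qed
  qed (use lo k_le S F_trivial in auto)
qed

lemma F_int_alg [simp]: "F i k \<in> int_alg"
proof (cases "1 \<le> i \<and> k \<le> N")
  case True
  then show ?thesis
    by (intro F_mem[where lo = 1]) (auto simp: pr_def)
next
  case False
  then show ?thesis
    by (auto simp: F_def)
qed

lemma F_cent:
  assumes a: "1 \<le> a" "a + 1 \<le> n" "odd N \<or> a + 2 \<le> n" and ik: "a + 2 \<le> i" "k \<le> pr (a + 2)"
  shows "F i k \<in> cong.cent (G a)"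
proof (cases "even N \<and> a + 2 = n")
  case True
  \<comment> \<open>At the fork \<open>G n\<close> does not commute with \<open>G a\<close>, but the
    only nontrivial element left in this range is the one from \<open>n\<close> to its mirror image,
    which is 0.\<close>
  then have "i \<noteq> n \<or> k \<noteq> pr n \<Longrightarrow> i < k \<Longrightarrow> False"
    using assms N_eq by (auto simp: pr_def)
  then consider "i < k" "F i k = 0" | "i = k" | "k < i"
    using True F_even_middle by (metis linorder_neqE_nat)
  then show ?thesis
    using assms True by cases (auto simp: F_trivial cong.cent_0 cong.cent_1 pr_def)
next
  case False
  then have "G l \<in> cong.cent (G a)" if "a + 2 \<le> l" "l \<le> n" for l
    using a that by (intro G_cent) auto
  then show ?thesis
    using assms by (intro F_mem[where lo = "a + 2"] cong.cent_0 cong.cent_1 cong.cent_scale cong.br_cent) auto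
qed

end

subsection \<open>Recursions in the rank\<close>

context so_column
begin

abbreviation eqv :: "hfield freealg \<Rightarrow> hfield freealg \<Rightarrow> bool"  (infix "\<approx>" 50)
  where "eqv \<equiv> cong.eqv"

text \<open>\<open>f_lo\<close> appends generators at the far end, while the induction needs the
  first generator split off. The appended ones with index at least \<open>a + 2\<close> commute with
  \<open>G a\<close>, so the brackets may be nested the other way round.\<close>

lemma FL_front:
  assumes "1 \<le> a" "a + 1 < k" "k \<le> n + 1" "\<And>l. a + 2 \<le> l \<Longrightarrow> l < k \<Longrightarrow> G l \<in> cong.cent (G a)"
  shows "FL a k \<approx> cong.br (FL (a + 1) k) (G a) (hconst qbar)"
  using assms(2-4)
proof (induction k)
  case (Suc k)
  show ?case
  proof (cases "k = a + 1")
    case True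
    then show ?thesis
      by (simp add: FL_Suc)
  next
    case False
    with Suc.prems have k: "a + 1 < k" "k \<le> n"
      by auto
    have M: "FL a k \<in> int_alg" "FL (a + 1) k \<in> int_alg"
      using k assms(1) by (auto intro!: FL_mem)
    have "cong.br (G k) (FL a k) (hconst qbar)
        \<approx> cong.br (G k) (cong.br (FL (a + 1) k) (G a) (hconst qbar)) (hconst qbar)"
      using Suc k M assms(1) by (intro cong.br_cong) auto
    also have "\<dots> \<approx> cong.br (cong.br (G k) (FL (a + 1) k) (hconst qbar)) (G a) (hconst qbar)"
      using Suc.prems k M assms(1) by (intro cong.br_left_nest) auto
    finally show ?thesis
      using k by (simp add: FL_Suc)
  qed
qed simp

lemma FH_front:
  assumes "1 \<le> a" "a + 1 < k" "k \<le> n + 1" "\<And>l. a + 2 \<le> l \<Longrightarrow> l < k \<Longrightarrow> G l \<in> cong.cent (G a)"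
  shows "FH a k \<approx> cong.br (G a) (FH (a + 1) k) (hconst qbar)"
  using assms(2-4)
proof (induction k)
  case (Suc k)
  show ?case
  proof (cases "k = a + 1")
    case True
    then show ?thesis
      by (simp add: FH_Suc)
  next
    case False
    with Suc.prems have k: "a + 1 < k" "k \<le> n"
      by auto
    have M: "FH a k \<in> int_alg" "FH (a + 1) k \<in> int_alg"
      using k assms(1) by (auto intro!: FH_mem)
    have "cong.br (FH a k) (G k) (hconst qbar)
        \<approx> cong.br (cong.br (G a) (FH (a + 1) k) (hconst qbar)) (G k) (hconst qbar)"
      using Suc k M assms(1) by (intro cong.br_cong) auto
    also have "\<dots> \<approx> cong.br (G a) (cong.br (FH (a + 1) k) (G k) (hconst qbar)) (hconst qbar)"
      using Suc.prems k M assms(1) by (intro cong.br_right_nest) auto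
    finally show ?thesis
      using k by (simp add: FH_Suc)
  qed
qed simp

text \<open>The only generator in this bracket that does not commute with \<open>G a\<close> is
  \<open>G (a + 1)\<close>, so its Serre relation is inherited.\<close>

lemma FL_serre_set:
  assumes "1 \<le> a" "a + 1 < k" "k \<le> n + 1" "G (a + 1) \<in> serre_set (G a)"
    and "\<And>l. a + 2 \<le> l \<Longrightarrow> l < k \<Longrightarrow> G l \<in> cong.cent (G a)"
  shows "FL (a + 1) k \<in> serre_set (G a)"
  using assms(2,3,5)
proof (induction k)
  case (Suc k)
  then show ?case
    using assms(1,4) by (cases "k = a + 1") (auto simp: FL_Suc intro!: cong.br_serre_set_left)
qed simp

lemma FH_serre_set:
  assumes "1 \<le> a" "a + 1 < k" "k \<le> n + 1" "G (a + 1) \<in> serre_set (G a)"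
    and "\<And>l. a + 2 \<le> l \<Longrightarrow> l < k \<Longrightarrow> G l \<in> cong.cent (G a)"
  shows "FH (a + 1) k \<in> serre_set (G a)"
  using assms(2,3,5)
proof (induction k)
  case (Suc k)
  then show ?case
    using assms(1,4) by (cases "k = a + 1") (auto simp: FH_Suc intro!: cong.br_serre_set_right)
qed simp

lemma F_odd_neq:
  assumes "odd N" "1 \<le> i" "i \<le> n" "1 \<le> z" "z \<le> n" "i \<noteq> z"
  shows "F i (pr z) = cong.br (FH z (n + 1)) (FL i (n + 1)) 1"
  using F_odd[OF assms(1-5)] assms(6) by simp

lemma F_even_neq:
  assumes "even N" "1 \<le> i" "i < n" "1 \<le> z" "z < n" "i \<noteq> z"
  shows "F i (pr z) = cong.br (FN z) (FL i n) (hconst qbar)"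
  using F_even[OF assms(1-5)] assms(6) by simp

section \<open>Relations between rows and columns \<open>a\<close> and \<open>a + 1\<close>\<close>

context
  fixes a :: nat
  assumes a: "1 \<le> a" "a + 1 \<le> s"
begin

lemma a_bounds: "a + 1 \<le> n" "odd N \<or> a + 2 \<le> n" "odd N \<or> a + 1 < n"
  using a rank_pos by (auto simp: s_def split: if_splits)

lemma G_cent_lower: "a + 2 \<le> l \<Longrightarrow> l \<le> n \<Longrightarrow> odd N \<or> l < n \<or> a + 2 < n \<Longrightarrow> G l \<in> cong.cent (G a)"
  using a by (intro G_cent) auto

lemma G_next_serre_set: "G (a + 1) \<in> serre_set (G a)"
  using a a_bounds by (intro G_serre_set) auto

lemma FL_cent: "a + 2 \<le> i \<Longrightarrow> i < k \<Longrightarrow> k \<le> n + 1 \<Longrightarrow> odd N \<or> k \<le> n \<Longrightarrow> FL i k \<in> cong.cent (G a)"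
  using a a_bounds by (intro FL_mem cong.br_cent G_cent_lower) auto

lemma FH_cent: "a + 2 \<le> i \<Longrightarrow> i < k \<Longrightarrow> k \<le> n + 1 \<Longrightarrow> odd N \<or> k \<le> n \<Longrightarrow> FH i k \<in> cong.cent (G a)"
  using a a_bounds by (intro FH_mem cong.br_cent G_cent_lower) auto

lemma FN_cent: "even N \<Longrightarrow> a + 2 \<le> z \<Longrightarrow> z < n \<Longrightarrow> FN z \<in> cong.cent (G a)"
  using a a_bounds FN_eq(1) FN_eq(2)[of z]
  by (cases "z = n - 1") (auto intro!: cong.br_cent FH_cent G_cent_lower)

lemma FL_next:
  "a + 1 < k \<Longrightarrow> k \<le> n + 1 \<Longrightarrow> odd N \<or> k \<le> n
    \<Longrightarrow> FL a k \<approx> cong.br (FL (a + 1) k) (G a) (hconst qbar)"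
  using a a_bounds by (intro FL_front G_cent_lower) auto

lemma FH_next:
  "a + 1 < k \<Longrightarrow> k \<le> n + 1 \<Longrightarrow> odd N \<or> k \<le> n
    \<Longrightarrow> FH a k \<approx> cong.br (G a) (FH (a + 1) k) (hconst qbar)"
  using a a_bounds by (intro FH_front G_cent_lower) auto

lemma FL_next_serre: "a + 1 < k \<Longrightarrow> k \<le> n + 1 \<Longrightarrow> odd N \<or> k \<le> n \<Longrightarrow> FL (a + 1) k \<in> serre_set (G a)"
  using a a_bounds by (intro FL_serre_set G_next_serre_set G_cent_lower) auto

lemma FH_next_serre: "a + 1 < k \<Longrightarrow> k \<le> n + 1 \<Longrightarrow> odd N \<or> k \<le> n \<Longrightarrow> FH (a + 1) k \<in> serre_set (G a)"
  using a a_bounds by (intro FH_serre_set G_next_serre_set G_cent_lower) auto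

lemma FL_int_alg: "1 \<le> i \<Longrightarrow> i < k \<Longrightarrow> k \<le> n + 1 \<Longrightarrow> FL i k \<in> int_alg"
  by (auto intro!: FL_mem)

lemma FH_int_alg: "1 \<le> i \<Longrightarrow> i < k \<Longrightarrow> k \<le> n + 1 \<Longrightarrow> FH i k \<in> int_alg"
  by (auto intro!: FH_mem)

lemma G_int_alg': "G a \<in> int_alg"
  using a a_bounds by simp

lemma FN_next:
  assumes "even N"
  shows "FN a \<approx> cong.br (G a) (FN (a + 1)) (hconst qbar)"
proof (cases "a + 1 = n - 1")
  case True
  then have "FN a = cong.br (FH a (Suc a)) (G n) (hconst qbar)"
    using FN_eq(2)[of a] by simp
  then show ?thesis
    using True FN_eq(1) FH_Suc(1) by simp
next
  case False
  \<comment> \<open>Away from the fork, \<open>G n\<close> commutes with \<open>G a\<close> and can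
    be moved across.\<close>
  then have n: "a + 1 < n - 1" "a + 2 < n"
    using a_bounds assms by auto
  have "cong.br (FH a (n - 1)) (G n) (hconst qbar)
      \<approx> cong.br (cong.br (G a) (FH (a + 1) (n - 1)) (hconst qbar)) (G n) (hconst qbar)"
    using a n assms by (intro cong.br_cong FH_next FH_int_alg cong.br_M) auto
  also have "\<dots> \<approx> cong.br (G a) (cong.br (FH (a + 1) (n - 1)) (G n) (hconst qbar)) (hconst qbar)"
    using a n by (intro cong.br_right_nest G_cent_lower FH_int_alg) auto
  finally show ?thesis
    using n FN_eq by simp
qed

lemma FN'_next:
  assumes "even N"
  shows "FN' a \<approx> cong.br (FN' (a + 1)) (G a) (hconst qbar)"
proof (cases "a + 1 = n - 1")
  case True
  then have "FN' a = cong.br (G n) (FL a (Suc a)) (hconst qbar)"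
    using FN'_eq(2)[of a] by simp
  then show ?thesis
    using True FN'_eq(1) FL_Suc(1) by simp
next
  case False
  then have n: "a + 1 < n - 1" "a + 2 < n"
    using a_bounds assms by auto
  have "cong.br (G n) (FL a (n - 1)) (hconst qbar)
      \<approx> cong.br (G n) (cong.br (FL (a + 1) (n - 1)) (G a) (hconst qbar)) (hconst qbar)"
    using a n assms by (intro cong.br_cong FL_next FL_int_alg cong.br_M) auto
  also have "\<dots> \<approx> cong.br (cong.br (G n) (FL (a + 1) (n - 1)) (hconst qbar)) (G a) (hconst qbar)"
    using a n by (intro cong.br_left_nest G_cent_lower FL_int_alg) auto
  finally show ?thesis
    using n FN'_eq by simp
qed

lemma FN_int_alg: "even N \<Longrightarrow> 1 \<le> i \<Longrightarrow> i < n \<Longrightarrow> FN i \<in> int_alg"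
  by (metis F_int_alg F_even_middle(3))

lemma FN_next_serre: "even N \<Longrightarrow> FN (a + 1) \<in> serre_set (G a)"
  using a a_bounds FN_eq(1) FN_eq(2)[of "a + 1"] rank_pos
  by (cases "a + 1 = n - 1")
    (auto intro!: cong.br_serre_set_right FH_next_serre[simplified] G_cent_lower G_last_serre_set G_int_alg')

lemma FN'_next_serre: "even N \<Longrightarrow> FN' (a + 1) \<in> serre_set (G a)"
  using a a_bounds FN'_eq(1) FN'_eq(2)[of "a + 1"] rank_pos
  by (cases "a + 1 = n - 1")
    (auto intro!: cong.br_serre_set_left FL_next_serre[simplified] G_cent_lower G_last_serre_set G_int_alg')

text \<open>In every region the dependence on the row sits in a factor \<open>FL\<close> or
  \<open>FN'\<close>, from which \<open>G a\<close> can be split off; the remaining factor,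
  \<open>FH z\<close> or \<open>FN z\<close> with \<open>z \<ge> a + 2\<close>, commutes with
  \<open>G a\<close>.\<close>

lemma F_row:
  assumes k: "a + 2 \<le> k" "k \<le> pr (a + 2)"
  shows "F a k \<approx> cong.br (F (a + 1) k) (G a) (hconst qbar)" (is ?row)
    and "F (a + 1) k \<in> serre_set (G a)" (is ?serre)
proof -
  have kN: "a < k" "k \<le> N"
    using k by (auto simp: pr_def)
  from a(1) kN have "?row \<and> ?serre"
  proof (cases rule: F_cases)
    case lo
    then have "k \<le> n + 1" "odd N \<or> k \<le> n"
      using N_eq by (cases "odd N"; auto)+
    then show ?thesis
      using k lo FL_next[of k] FL_next_serre[of k] F_lo[of "a + 1" k] by simp
  next
    case hi
    then show ?thesis
      using a_bounds N_eq by (cases "odd N") auto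
  next
    case (odd z)
    \<comment> \<open>Thus \<open>z\<close> differs from both rows, and the Kronecker symbol in the
      formula vanishes for \<open>a\<close> and for \<open>a + 1\<close>.\<close>
    then have z: "a + 2 \<le> z"
      using k N_eq by (auto simp: pr_def)
    have eq: "F a k = cong.br (FH z (n + 1)) (FL a (n + 1)) 1"
      "F (a + 1) k = cong.br (FH z (n + 1)) (FL (a + 1) (n + 1)) 1"
      using odd z a a_bounds F_odd_neq[of a z] F_odd_neq[of "a + 1" z] by auto
    have "cong.br (FH z (n + 1)) (FL a (n + 1)) 1
        \<approx> cong.br (FH z (n + 1)) (cong.br (FL (a + 1) (n + 1)) (G a) (hconst qbar)) 1"
      using odd z a a_bounds G_int_alg'
      by (intro cong.br_cong FL_next FL_int_alg FH_int_alg cong.br_M) auto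
    also have "\<dots> \<approx> cong.br (cong.br (FH z (n + 1)) (FL (a + 1) (n + 1)) 1) (G a) (hconst qbar)"
      using odd z a a_bounds G_int_alg' by (intro cong.br_left_nest FH_cent FL_int_alg) auto
    finally have ?row
      by (simp only: eq)
    moreover have ?serre
      unfolding eq using odd z a a_bounds G_int_alg'
      by (intro cong.br_serre_set_left FH_cent FL_next_serre) auto
    ultimately show ?thesis ..
  next
    case middle
    then show ?thesis
      using a_bounds by auto
  next
    case to_npr
    then show ?thesis
      using FN'_next FN'_next_serre F_even_middle(2)[of "a + 1"] a_bounds by auto
  next
    case (from_n z)
    then show ?thesis
      using a_bounds by auto
  next
    case (even z)
    then have z: "a + 2 \<le> z"
      using k N_eq by (auto simp: pr_def)
    have eq: "F a k = cong.br (FN z) (FL a n) (hconst qbar)"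
      "F (a + 1) k = cong.br (FN z) (FL (a + 1) n) (hconst qbar)"
      using even z a a_bounds F_even_neq[of a z] F_even_neq[of "a + 1" z] by auto
    have "cong.br (FN z) (FL a n) (hconst qbar)
        \<approx> cong.br (FN z) (cong.br (FL (a + 1) n) (G a) (hconst qbar)) (hconst qbar)"
      using even z a a_bounds G_int_alg'
      by (intro cong.br_cong FL_next FL_int_alg FN_int_alg cong.br_M) auto
    also have "\<dots> \<approx> cong.br (cong.br (FN z) (FL (a + 1) n) (hconst qbar)) (G a) (hconst qbar)"
      using even z a a_bounds G_int_alg' by (intro cong.br_left_nest FN_cent FL_int_alg) auto
    finally have ?row
      by (simp only: eq)
    moreover have ?serre
      unfolding eq using even z a a_bounds G_int_alg'
      by (intro cong.br_serre_set_left FN_cent FL_next_serre) auto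
    ultimately show ?thesis ..
  qed
  then show ?row ?serre
    by blast+
qed

text \<open>The mirror image of \<open>F_row\<close>: the dependence on the column sits in
  \<open>FH\<close> or \<open>FN\<close>, and the factor \<open>FL m\<close> commutes with
  \<open>G a\<close>.\<close>

lemma F_col:
  assumes m: "a + 2 \<le> m" "m \<le> pr (a + 2)"
  shows "F m (pr a) \<approx> cong.br (G a) (F m (pr (a + 1))) (hconst qbar)" (is ?col)
    and "F m (pr (a + 1)) \<in> serre_set (G a)" (is ?serre)
proof -
  have mN: "1 \<le> m" "m < pr a" "pr a \<le> N" "m < pr (a + 1)" "pr (a + 1) \<le> N"
    using m a by (auto simp: pr_def)
  have pr_inj: "a = z" if "pr a = pr z" "z \<le> n" for z
    using that a_bounds by (auto simp: pr_def n_def)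
  from mN(1-3) have "?col \<and> ?serre"
  proof (cases rule: F_cases)
    case lo
    then show ?thesis
      using a_bounds N_eq by (cases "odd N") (auto simp: pr_def)
  next
    case hi
    then have p: "a + 1 < pr m" "pr m \<le> n + 1" "odd N \<or> pr m \<le> n"
      using m N_eq mN by (cases "odd N"; auto simp: pr_def)+
    have "F m (pr a) = FH a (pr m)" "F m (pr (a + 1)) = FH (a + 1) (pr m)"
      using hi F_hi[of m "pr (a + 1)"] mN pr_pr[of a] pr_pr[of "a + 1"] a_bounds by (auto simp: n_def)
    then show ?thesis
      using FH_next[OF p] FH_next_serre[OF p] by simp
  next
    case (odd z)
    have eq: "F m (pr a) = cong.br (FH a (n + 1)) (FL m (n + 1)) 1"
      "F m (pr (a + 1)) = cong.br (FH (a + 1) (n + 1)) (FL m (n + 1)) 1"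
      using odd m a a_bounds F_odd_neq[of m a] F_odd_neq[of m "a + 1"] by auto
    have "cong.br (FH a (n + 1)) (FL m (n + 1)) 1
        \<approx> cong.br (cong.br (G a) (FH (a + 1) (n + 1)) (hconst qbar)) (FL m (n + 1)) 1"
      using odd m a a_bounds G_int_alg'
      by (intro cong.br_cong FH_next FL_int_alg FH_int_alg cong.br_M) auto
    also have "\<dots> \<approx> cong.br (G a) (cong.br (FH (a + 1) (n + 1)) (FL m (n + 1)) 1) (hconst qbar)"
      using odd m a a_bounds G_int_alg' by (intro cong.br_right_nest FL_cent FH_int_alg) auto
    finally have ?col
      by (simp only: eq)
    moreover have ?serre
      unfolding eq using odd m a a_bounds G_int_alg'
      by (intro cong.br_serre_set_right FL_cent FH_next_serre) auto
    ultimately show ?thesis ..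
  next
    case middle
    then show ?thesis
      using pr_inj[of n] a_bounds by auto
  next
    case to_npr
    then show ?thesis
      using pr_inj[of n] a_bounds by auto
  next
    case (from_n z)
    then show ?thesis
      using FN_next FN_next_serre F_even_middle(3)[of a] F_even_middle(3)[of "a + 1"] a a_bounds by auto
  next
    case (even z)
    have eq: "F m (pr a) = cong.br (FN a) (FL m n) (hconst qbar)"
      "F m (pr (a + 1)) = cong.br (FN (a + 1)) (FL m n) (hconst qbar)"
      using even m a a_bounds F_even_neq[of m a] F_even_neq[of m "a + 1"] by auto
    have "cong.br (FN a) (FL m n) (hconst qbar)
        \<approx> cong.br (cong.br (G a) (FN (a + 1)) (hconst qbar)) (FL m n) (hconst qbar)"
      using even m a a_bounds G_int_alg'
      by (intro cong.br_cong FN_next FL_int_alg FN_int_alg cong.br_M) auto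
    also have "\<dots> \<approx> cong.br (G a) (cong.br (FN (a + 1)) (FL m n) (hconst qbar)) (hconst qbar)"
      using even m a a_bounds G_int_alg' by (intro cong.br_right_nest FL_cent FN_int_alg) auto
    finally have ?col
      by (simp only: eq)
    moreover have ?serre
      unfolding eq using even m a a_bounds G_int_alg'
      by (intro cong.br_serre_set_right FL_cent FN_next_serre) auto
    ultimately show ?thesis ..
  qed
  then show ?col ?serre
    by blast+
qed

text \<open>All four elements at the corners are q-commutators of one element into and one element
  out of a common middle index \<open>c\<close>, which is the situation of
  \<open>corner_relations_cong\<close>.\<close>

lemma corner:
  shows "F a (pr (a + 1)) * G a - G a * F (a + 1) (pr a) \<approx>
      smul (hconst (1 / (q + qbar)))
        (F (a + 1) (pr (a + 1)) * G a * G a - G a * G a * F (a + 1) (pr (a + 1)))" (is ?PQ)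
    and "F a (pr a) \<approx> smul (hconst q) (F a (pr (a + 1)) * G a)
        - smul (hconst qbar) (G a * F (a + 1) (pr a))
        - F (a + 1) (pr (a + 1)) * G a * G a + G a * F (a + 1) (pr (a + 1)) * G a" (is ?R)
proof -
  define c where "c = (if odd N then n + 1 else n)"
  \<comment> \<open>The coefficient of the reversed product: \<open>q^d * qbar^d\<close> for odd
    \<open>N\<close> and \<open>q^d * qbar^(1+d)\<close> for even \<open>N\<close>, the same for
    \<open>d = 0\<close> and \<open>d = 1\<close>.\<close>
  define \<kappa> where "\<kappa> = (if odd N then 1 else hconst qbar)"
  have \<kappa>: "\<kappa> \<in> alg_A j"
    by (simp add: \<kappa>_def)
  have c: "a + 2 \<le> c" "c \<le> pr (a + 2)"
    using a_bounds N_eq by (auto simp: c_def pr_def)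
  have eq: "F x (pr z) = smul (if x = z then hconst q else 1) (F c (pr z) * F x c) - smul \<kappa> (F x c * F c (pr z))"
    if xz: "x \<in> {a, a + 1}" "z \<in> {a, a + 1}" for x z
  proof (cases "odd N")
    case True
    have "pr c = n + 1" "pr (pr z) = z" "c < pr z" "pr z \<le> N" "N + 1 \<le> 2 * c" "2 * c \<le> N + 1" "x < c" "1 \<le> x"
      using True xz a a_bounds N_eq(1) by (auto simp: c_def pr_def)
    then have "F x c = FL x (n + 1)" "F c (pr z) = FH z (n + 1)"
      using True F_lo[of x c] F_hi[of c "pr z"] by (simp_all add: c_def)
    moreover have "F x (pr z) = (let d = if x = z then 1 else 0 in
        smul (hconst q ^ d) (cong.br (FH z (n + 1)) (FL x (n + 1)) (hconst qbar ^ d)))"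
      using True xz a a_bounds by (intro F_odd) auto
    ultimately show ?thesis
      using True
      by (simp add: Let_def cong.br_def \<kappa>_def cong.scale_right_diff_distrib flip: hconst_mult)
  next
    case False
    have "F x c = FL x n" "F c (pr z) = FN z"
      using False xz a a_bounds N_eq F_lo[of x c] F_even_middle(3)[of z] by (auto simp: c_def)
    moreover have "F x (pr z) = (let d = if x = z then 1 else 0 in
        smul (hconst q ^ d) (cong.br (FN z) (FL x n) (hconst qbar ^ (1 + d))))"
      using False xz a a_bounds by (intro F_even) auto
    ultimately show ?thesis
      using False
      by (simp add: Let_def cong.br_def \<kappa>_def cong.scale_right_diff_distrib mult.assoc[symmetric] flip: hconst_mult)
  qed
  note rel = cong.corner_relations_cong[of "G a" "F (a + 1) c" "F c (pr (a + 1))" "F a c" "F c (pr a)" \<kappa>,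
      OF G_int_alg' _ _ _ _ \<kappa> cong.serre_set_J[OF F_row(2)[OF c]] cong.serre_set_J[OF F_col(2)[OF c]]
        F_row(1)[OF c] F_col(1)[OF c]]
  show ?PQ
    using rel(1) eq[of a "a + 1"] eq[of "a + 1" a] eq[of "a + 1" "a + 1"] by simp
  show ?R
    using rel(2) eq[of a "a + 1"] eq[of "a + 1" a] eq[of "a + 1" "a + 1"] eq[of a a] by simp
qed

lemma symmetric_paths_step:
  assumes "\<And>l. l \<in> {a + 1..pr (a + 1)} \<Longrightarrow> \<alpha> l \<in> alg_A j"
    and "\<And>x. x \<in> int_alg \<Longrightarrow> smul (\<alpha> (a + 1) + \<alpha> (pr (a + 1))
      + (hconst q - hconst qbar) * \<alpha> (a + 1) * \<alpha> (pr (a + 1))) x \<in> div_ideal"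
    and "cong.paths \<alpha> F (a + 1) [a + 2..<pr (a + 1)] (pr (a + 1)) \<in> div_ideal"
  shows "cong.paths \<alpha> F a [a + 1..<pr a] (pr a) \<in> div_ideal"
proof -
  have "a + 2 < pr (a + 1)" "pr a = Suc (pr (a + 1))"
    using a_bounds N_eq by (cases "odd N"; auto simp: pr_def)+
  then have split: "[a + 1..<pr a] = (a + 1) # [a + 2..<pr (a + 1)] @ [pr (a + 1)]"
    by (simp add: upt_conv_Cons)
  have ls: "a + 2 \<le> l \<and> l \<le> pr (a + 2)" if "l \<in> set [a + 2..<pr (a + 1)]" for l
    using that by (auto simp: pr_def)
  have e: "F a (a + 1) = G a" "F (pr (a + 1)) (pr a) = G a"
    using a a_bounds N_eq F_lo[of a "a + 1"] F_hi[of "pr (a + 1)" "pr a"]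
    by (cases "odd N"; auto simp: FL_Suc FH_Suc pr_def Suc_diff_Suc)+
  show ?thesis
    unfolding split
  proof (rule cong.paths_step[where e = "G a"])
    show "F a (a + 1) = G a" "F (pr (a + 1)) (pr a) = G a"
      by (fact e)+
    show "F a l \<approx> cong.br (F (a + 1) l) (G a) (hconst qbar)" "F l (pr a) \<approx> cong.br (G a) (F l (pr (a + 1))) (hconst qbar)"
      "cong.serre (G a) (F (a + 1) l) \<in> div_ideal" "cong.serre (G a) (F l (pr (a + 1))) \<in> div_ideal"
      if "l \<in> set [a + 2..<pr (a + 1)]" for l
      using F_row[of l] F_col[of l] ls[OF that] by (blast intro: cong.serre_set_J)+
    show "F l m \<in> cong.cent (G a)"
      if "l \<in> set [a + 2..<pr (a + 1)]" "m \<in> set [a + 2..<pr (a + 1)]" for l m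
      using ls that a a_bounds by (intro F_cent) auto
    show "\<alpha> l \<in> alg_A j" if "l \<in> set [a + 2..<pr (a + 1)] \<union> {a + 1, pr (a + 1)}" for l
      using that \<open>a + 2 < pr (a + 1)\<close> by (intro assms(1)) auto
  qed (use corner assms(2,3) in auto)
qed

end

end

subsection \<open>The coefficients \<open>A\<^sub>l\<close> and divisibility\<close>

context so_column
begin

lemma eps_pr: "1 \<le> l \<Longrightarrow> l \<le> N \<Longrightarrow> eps (pr l) = - eps l"
  by (auto simp: eps_def pr_def)

lemma rho_pr: "1 \<le> l \<Longrightarrow> l \<le> N \<Longrightarrow> rho (pr l) = - rho l"
  by (simp add: rho_def eps_pr ip_uminus sum_negf)

lemma index_cases:
  assumes "1 \<le> l" "l \<le> N"
  obtains (lo) "l \<in> {1..n}" | (hi) "pr l \<in> {1..n}" "eps l = - eps (pr l)" | (mid) "2 * l = N + 1"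
proof -
  have "l \<in> {1..n} \<or> pr l \<in> {1..n} \<or> 2 * l = N + 1"
    using assms N_eq by (cases "odd N") (auto simp: pr_def)
  with lo hi mid eps_pr[OF assms] show thesis
    by fastforce
qed

lemma ip_eps_self:
  assumes "1 \<le> l" "l \<le> N" "2 * l \<noteq> N + 1"
  shows "ip (eps l) (eps l) = 1"
  using assms(1,2) by (cases rule: index_cases) (use assms(3) in \<open>simp_all add: ip_uminus ip_eps\<close>)

lemma ip_eps_orthogonal:
  assumes "1 \<le> l" "l \<le> N" "1 \<le> k" "k \<le> N" "l \<noteq> k" "l \<noteq> pr k"
  shows "ip (eps l) (eps k) = 0"
proof -
  have "pr l \<noteq> pr k" "pr l \<noteq> k"
    using assms by (auto simp: pr_def)
  moreover have "eps x = 0" if "2 * x = N + 1" for x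
    using that by (auto simp: eps_def)
  ultimately show ?thesis
    using assms(5,6)
    by - (rule index_cases[OF assms(1,2)]; rule index_cases[OF assms(3,4)];
      force simp: ip_uminus ip_eps ip_0)
qed

text \<open>If two of these weights agreed, their inner product would be the squared length 1 of a
  nonzero one among them; but it is 0 or, for opposite weights, -1.\<close>

lemma eps_inj:
  assumes "1 \<le> l" "l \<le> N" "1 \<le> k" "k \<le> N" "l \<noteq> k"
  shows "eps l \<noteq> eps k"
proof
  assume eq: "eps l = eps k"
  show False
  proof (cases "l = pr k \<or> 2 * l = N + 1 \<or> 2 * k = N + 1")
    case True
    then have "ip (eps l) (eps k) \<le> 0"
    proof (elim disjE)
      assume l: "l = pr k"
      then have "2 * k \<noteq> N + 1"
        using assms by (auto simp: pr_def)
      with l assms show ?thesis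
        by (simp add: eps_pr ip_uminus ip_eps_self)
    qed (auto simp: eps_def ip_0)
    moreover have "ip (eps l) (eps k) = 1"
    proof (cases "2 * l = N + 1")
      case True
      then have "2 * k \<noteq> N + 1"
        using assms(5) by auto
      with assms show ?thesis
        by (simp add: eq ip_eps_self)
    next
      case False
      with assms show ?thesis
        by (simp add: ip_eps_self flip: eq)
    qed
    ultimately show False
      by simp
  next
    case False
    then show False
      using assms ip_eps_self[of k] ip_eps_orthogonal[of l k] by (simp add: eq)
  qed
qed

lemma qh_mult: "qh \<mu> c * qh \<nu> d = qh (\<mu> + \<nu>) (c + d)"
  by (simp add: qh_def mult_single qpow_def distrib_right exp_add)

lemma hconst_qpow: "hconst (qpow c) = qh 0 c"
  by (simp add: hconst_def qh_def)

lemma qh_neq_1: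
  assumes "\<mu> \<noteq> 0"
  shows "qh \<mu> c \<noteq> 1"
proof
  assume "qh \<mu> c = 1"
  then have "Poly_Mapping.single \<mu> (qpow c) = 1"
    by (simp add: qh_def One_fract_def eq_fract)
  then have "Poly_Mapping.lookup (Poly_Mapping.single \<mu> (qpow c)) \<mu> = Poly_Mapping.lookup 1 \<mu>"
    by simp
  then show False
    using assms by (simp add: lookup_one qpow_def)
qed

text \<open>This makes the denominator of \<open>A l j\<close> nonzero: \<open>y l j\<close> is a
  monomial with a nonzero weight, because weights have no torsion.\<close>

lemma y_neq_1:
  assumes "1 \<le> l" "l \<le> N" "l \<noteq> j"
  shows "y l j \<noteq> 1"
proof -
  have "- (\<mu> + \<mu>) = 0 \<Longrightarrow> \<mu> = 0" for \<mu> :: weight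
  proof (rule poly_mapping_eqI)
    fix k assume "- (\<mu> + \<mu>) = 0"
    then have "Poly_Mapping.lookup (- (\<mu> + \<mu>)) k = 0"
      by (simp only: lookup_zero)
    then show "Poly_Mapping.lookup \<mu> k = Poly_Mapping.lookup 0 k"
      by (simp only: lookup_uminus lookup_add) simp
  qed
  moreover have "eps l - eps j \<noteq> 0"
    using eps_inj[OF assms(1,2) j_le assms(3)] by simp
  ultimately show ?thesis
    unfolding y_def Let_def by (intro qh_neq_1) blast
qed

lemma y_pr:
  assumes "2 * j \<noteq> N + 1"
  shows "y (pr j) j = qh (4 * eps j) (4 * rho j + 4)"
proof -
  have "ip (- eps j - eps j) (- eps j - eps j) = 4"
    unfolding ip_diff ip_uminus using assms j_le by (simp add: ip_eps_self)
  then show ?thesis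
    using j_le by (simp only: y_def eps_pr rho_pr Let_def) (simp add: algebra_simps)
qed

text \<open>The contributions of \<open>eps l\<close> and \<open>rho l\<close> cancel against those
  of the mirror image, and the squared lengths \<open>2 + 2\<close> add up to that of
  \<open>2 * eps j\<close>, which is 4.\<close>

lemma y_reflect:
  assumes "1 \<le> l" "l \<le> N" "l \<noteq> j" "l \<noteq> pr j" "2 * l \<noteq> N + 1" "2 * j \<noteq> N + 1"
  shows "y l j * y (pr l) j = y (pr j) j"
proof -
  have "j \<noteq> pr l"
    using assms j_le by (auto simp: pr_def)
  then have "ip (eps l) (eps j) = 0" "ip (eps j) (eps l) = 0"
    using assms j_le by (auto intro!: ip_eps_orthogonal)
  then have "y l j = qh (2 * eps j - 2 * eps l) (2 * rho j - 2 * rho l + 2)"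
    "y (pr l) j = qh (2 * eps j + 2 * eps l) (2 * rho j + 2 * rho l + 2)"
    using assms j_le
    by (simp_all add: y_def eps_pr rho_pr ip_diff ip_add ip_uminus ip_eps_self algebra_simps)
  then show ?thesis
    using y_pr[OF assms(6)] by (simp add: qh_mult algebra_simps)
qed

lemma y_middle:
  assumes "odd N" "2 * j \<noteq> N + 1"
  shows "(hconst q * y (n + 1) j) ^ 2 = y (pr j) j"
proof -
  have eps: "eps (n + 1) = 0"
    using N_eq(1)[OF assms(1)] by (simp add: eps_def)
  then have "rho (n + 1) = 0"
    by (simp add: rho_def ip_0)
  with eps have "y (n + 1) j = qh (2 * eps j) (2 * rho j + 1)"
    using assms j_le by (simp add: y_def ip_uminus ip_eps_self algebra_simps)
  then show ?thesis
    using y_pr[OF assms(2)]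
    by (simp add: power2_eq_square q_def hconst_qpow qh_mult algebra_simps)
qed

definition \<omega> :: complex where "\<omega> = q - qbar"

definition ainv :: "nat \<Rightarrow> hfield" where "ainv l = inverse (A l j)"

lemma ainv_eq: "ainv l = (y l j - 1) / hconst \<omega>"
  by (simp add: ainv_def A_def \<omega>_def)

lemma ainv_eq': "ainv l = hconst (1 / \<omega>) * (y l j - 1)"
proof -
  have "hconst \<omega> * hconst (1 / \<omega>) = 1" "hconst \<omega> \<noteq> 0"
    using q_minus_qbar by (simp_all add: \<omega>_def flip: hconst_mult)
  then show ?thesis
    by (simp add: ainv_eq field_simps)
qed

lemma ainv_alg_A:
  assumes "l \<in> {1..N}" "prec l j"
  shows "ainv l \<in> alg_A j"
  unfolding ainv_eq'
  using assms by (intro alg_A.intros(5) alg_A.intros(1) cong.B_diff alg_A_1 alg_A.intros(2)) auto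

lemma A_ainv: "1 \<le> l \<Longrightarrow> l \<le> N \<Longrightarrow> l \<noteq> j \<Longrightarrow> A l j * ainv l = 1"
  using y_neq_1[of l] q_minus_qbar by (simp add: A_def ainv_def)

lemma prec_iff_upper: "n + 2 \<le> k \<Longrightarrow> prec l k \<longleftrightarrow> l < k"
  by (auto simp: prec_def)

section \<open>Columns with \<open>pr s \<le> j\<close>\<close>

context
  assumes upper: "pr s \<le> j"
begin

lemma upper_bounds: "n + 2 \<le> j" "1 \<le> pr j" "pr j \<le> s" "s \<le> n" "pr j \<le> n" "2 * j \<noteq> N + 1"
  using upper j_le N_eq rank_pos by (cases "odd N"; auto simp: pr_def s_def)+

text \<open>For even \<open>N\<close> the two elements coincide. For odd \<open>N\<close>,
  \<open>y (pr j) j - 1\<close> is a difference of squares by \<open>y_middle\<close>, and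
  \<open>delta_minus j\<close> is one factor up to a scalar.\<close>

lemma ainv_pr_divisible: "\<exists>c\<in>alg_A j. ainv (pr j) = delta_minus j * c"
proof (cases "odd N")
  case True
  have h: "hconst \<omega> \<noteq> 0" "hconst (q + 1) \<noteq> 0"
    using q_minus_qbar q_plus_1 by (simp_all add: \<omega>_def)
  let ?y = "hconst q * y (n + 1) j"
  have "y (n + 1) j \<in> alg_A j"
    using True upper_bounds N_eq by (intro alg_A.intros(2)) (auto simp: prec_iff_upper)
  then have "hconst ((q + 1) / \<omega>) * (?y - 1) \<in> alg_A j"
    by (intro alg_A.intros(5) cong.B_diff alg_A_1) auto
  moreover have "ainv (pr j) = delta_minus j * (hconst ((q + 1) / \<omega>) * (?y - 1))"
  proof -
    have "hconst ((q + 1) / \<omega>) * hconst \<omega> = hconst (q + 1)"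
      using h by (simp flip: hconst_mult)
    then have "hconst ((q + 1) / \<omega>) = hconst (q + 1) / hconst \<omega>"
      using h by (simp add: field_simps)
    moreover have "ainv (pr j) = (?y ^ 2 - 1) / hconst \<omega>"
      using y_middle[OF True upper_bounds(6)] by (simp add: ainv_eq)
    moreover have "?y ^ 2 - 1 = (?y + 1) * (?y - 1)"
      by (simp add: power2_eq_square algebra_simps)
    ultimately show ?thesis
      using True upper h by (simp add: delta_minus_def)
  qed
  ultimately show ?thesis
    by blast
next
  case False
  then have "ainv (pr j) = delta_minus j * 1"
    using upper by (simp add: ainv_eq delta_minus_def \<omega>_def)
  then show ?thesis
    using alg_A_1 by blast
qed

lemma ainv_pr_div_ideal:
  assumes "x \<in> int_alg"
  shows "smul (ainv (pr j)) x \<in> div_ideal"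
proof -
  obtain c where "c \<in> alg_A j" "ainv (pr j) = delta_minus j * c"
    using ainv_pr_divisible by blast
  with assms show ?thesis
    using delta_div_ideal[OF int_alg_smul] by (simp add: smul_smul)
qed

text \<open>Since \<open>1 + hconst \<omega> * ainv l = y l j\<close>, this is the product formula
  \<open>y_reflect\<close> in additive form.\<close>

lemma ainv_reflect:
  assumes "pr j < l" "l < j" "2 * l \<noteq> N + 1"
  shows "ainv l + ainv (pr l) + (hconst q - hconst qbar) * ainv l * ainv (pr l) = ainv (pr j)"
proof -
  have h: "hconst \<omega> \<noteq> 0" "hconst q - hconst qbar = hconst \<omega>"
    using q_minus_qbar by (simp_all add: \<omega>_def flip: hconst_diff)
  have "y l j * y (pr l) j = y (pr j) j"
    using assms j_le upper_bounds by (intro y_reflect) auto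
  then have "y (pr j) j - 1 = (y l j - 1) + (y (pr l) j - 1) + (y l j - 1) * (y (pr l) j - 1)"
    by (simp add: algebra_simps)
  then show ?thesis
    using h by (simp add: ainv_eq field_simps)
qed

text \<open>Only the middle index \<open>n + 1\<close> lies between, so the path sum is a multiple
  of the square of \<open>G n\<close>. Its coefficient is \<open>delta_minus j\<close> itself, which
  explains the form of that element for odd \<open>N\<close>.\<close>

lemma top_odd:
  assumes "odd N"
  shows "cong.paths ainv F n [n + 1..<pr n] (pr n) \<in> div_ideal"
proof -
  have N: "N = 2 * n + 1"
    using N_eq assms by simp
  have n: "1 \<le> n"
    using rank_pos by simp
  have pr_n: "pr n = n + 2" and "pr (n + 2) = n" "pr (n + 1) = n + 1"
    using N by (simp_all add: pr_def)
  then have "F n (n + 1) = FL n (Suc n)" "F (n + 1) (n + 2) = FH n (Suc n)"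
    using n N F_lo[of n "n + 1"] F_hi[of "n + 1" "n + 2"] by simp_all
  then have F: "F n (n + 1) = G n" "F (n + 1) (n + 2) = G n"
    by (simp_all only: FL_Suc FH_Suc)
  have "F n (n + 2) = smul (hconst q) (cong.br (G n) (G n) (hconst qbar))"
    using F_odd[of n n] assms n pr_n by (simp add: FL_Suc FH_Suc)
  then have F': "F n (n + 2) = smul (hconst (q - 1)) (G n * G n)"
    by (simp add: cong.br_def hconst_diff algebra_simps flip: hconst_mult)
  have h: "hconst (q + 1) \<noteq> 0" "hconst \<omega> \<noteq> 0"
    using q_plus_1 q_minus_qbar by (simp_all add: \<omega>_def)
  have delta: "delta_minus j = (hconst q * y (n + 1) j + 1) / hconst (q + 1)"
    using upper assms by (simp add: delta_minus_def)
  \<comment> \<open>So \<open>(q - 1) / \<omega>\<close> is \<open>q / (q + 1)\<close>, the source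
    of the denominator of \<open>delta_minus j\<close>.\<close>
  have "(q - 1) * (q + 1) = \<omega> * q"
    by (simp add: \<omega>_def algebra_simps)
  then have "hconst (q - 1) * hconst (q + 1) = hconst \<omega> * hconst q"
    by (simp flip: hconst_mult)
  then have "ainv (n + 1) * hconst (q - 1) = (y (n + 1) j - 1) * hconst q / hconst (q + 1)"
    using h by (simp add: ainv_eq field_simps)
  moreover have "(y (n + 1) j - 1) * hconst q / hconst (q + 1) + 1 = delta_minus j"
    using h by (simp add: delta field_simps hconst_add)
  ultimately have eq: "ainv (n + 1) * hconst (q - 1) + 1 = delta_minus j"
    by simp
  have "[n + 1..<pr n] = [n + 1]" "pr n = n + 2"
    by (simp_all add: pr_n)
  then have "cong.paths ainv F n [n + 1..<pr n] (pr n) = smul (ainv (n + 1) * hconst (q - 1) + 1) (G n * G n)"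
    using F F' by (simp add: cong.scale_left_distrib)
  then show ?thesis
    unfolding eq using n by (auto intro!: delta_div_ideal int_alg_mult)
qed

text \<open>Between lie \<open>n\<close> and its mirror image, which are incomparable. The path sum
  is a combination of the two products of \<open>G (n - 1)\<close> and \<open>G n\<close>; as these
  commute, only the total coefficient matters, and \<open>ainv_reflect\<close> identifies
  it.\<close>

lemma top_even:
  assumes "even N"
  shows "cong.paths ainv F (n - 1) [n..<pr (n - 1)] (pr (n - 1)) \<in> div_ideal"
proof -
  have N: "N = 2 * n"
    using N_eq assms by simp
  have n: "3 \<le> n"
    using rank_pos assms by simp
  have pr: "pr n = n + 1" "pr (n - 1) = n + 2" "pr (n + 1) = n" "pr (n + 2) = n - 1"
    using N n by (auto simp: pr_def)
  let ?e = "G (n - 1)" and ?g = "G n"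
  have "F (n - 1) n = FL (n - 1) (Suc (n - 1))" "F (n + 1) (n + 2) = FH (n - 1) (Suc (n - 1))"
    using n N F_lo[of "n - 1" n] F_hi[of "n + 1" "n + 2"] pr by simp_all
  then have F: "F (n - 1) n = ?e" "F (n + 1) (n + 2) = ?e"
    by (simp_all only: FL_Suc FH_Suc)
  have n': "1 \<le> n - 1" "n - 1 < n"
    using n by auto
  have F': "F n (n + 1) = 0" "F (n - 1) (n + 1) = ?g" "F n (n + 2) = ?g"
    using F_even_middle(1)[OF assms] F_even_middle(2,3)[OF assms n'] pr FN_eq(1) FN'_eq(1) by simp_all
  have FLn: "FL (n - 1) n = ?e"
    using FL_Suc(1)[of "n - 1"] n by simp
  have "F (n - 1) (n + 2) = smul (hconst q) (cong.br ?g ?e (hconst qbar * hconst qbar))"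
    using F_even[OF assms n' n'] unfolding pr FN_eq(1) FLn by simp
  then have F'': "F (n - 1) (n + 2) = smul (hconst q) (?g * ?e) - smul (hconst qbar) (?e * ?g)"
    by (simp add: cong.br_def algebra_simps)
  have "[n..<n + 2] = [n, n + 1]"
    by (simp add: upt_conv_Cons)
  then have "[n..<pr (n - 1)] = [n, n + 1]"
    unfolding pr by simp
  then have "cong.paths ainv F (n - 1) [n..<pr (n - 1)] (pr (n - 1)) =
      smul (ainv n) (smul (ainv (n + 1)) (F (n - 1) (n + 2)) + F (n - 1) (n + 1) * F (n + 1) (n + 2))
      + F (n - 1) n * (smul (ainv (n + 1)) (F n (n + 2)) + F n (n + 1) * F (n + 1) (n + 2))"
    using pr by simp
  also have "\<dots> = smul (ainv n + ainv (n + 1) + (hconst q - hconst qbar) * ainv n * ainv (n + 1)) (?e * ?g)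
      + smul (ainv n * ainv (n + 1) * hconst q + ainv n) (?g * ?e - ?e * ?g)"
    unfolding F F' F'' by (simp add: algebra_simps)
  also have "\<dots> \<in> div_ideal"
  proof (rule cong.J_add)
    have "ainv n + ainv (n + 1) + (hconst q - hconst qbar) * ainv n * ainv (n + 1) = ainv (pr j)"
      using ainv_reflect[of n] upper_bounds assms N pr by (auto simp: s_def)
    then show "smul (ainv n + ainv (n + 1) + (hconst q - hconst qbar) * ainv n * ainv (n + 1)) (?e * ?g) \<in> div_ideal"
      using n by (auto intro!: ainv_pr_div_ideal int_alg_mult)
    have "ainv n \<in> alg_A j" "ainv (n + 1) \<in> alg_A j"
      using upper_bounds n N by (auto intro!: ainv_alg_A simp: prec_iff_upper)
    then show "smul (ainv n * ainv (n + 1) * hconst q + ainv n) (?g * ?e - ?e * ?g) \<in> div_ideal"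
      by (intro cong.J_scale cong.cent_J G_last_cent assms) auto
  qed
  finally show ?thesis .
qed

lemma symmetric_paths:
  assumes "pr j \<le> a" "a \<le> s"
  shows "cong.paths ainv F a [a + 1..<pr a] (pr a) \<in> div_ideal"
  using assms(2)
proof (induction a rule: inc_induct)
  \<comment> \<open>The innermost symmetric interval: one index strictly inside for odd
    \<open>N\<close>, two for even \<open>N\<close>.\<close>
  case base
  show ?case
  proof (cases "odd N")
    case True
    then show ?thesis
      using top_odd by (simp add: s_def)
  next
    case False
    then show ?thesis
      using top_even rank_pos by (simp add: s_def)
  qed
next
  case (step a)
  have a: "1 \<le> a" "a + 1 \<le> s"
    using step assms(1) upper_bounds by auto
  have l: "1 \<le> l" "l < j" if "l \<in> {a + 1..pr (a + 1)}" for l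
    using that a step upper_bounds assms(1) j_le by (auto simp: pr_def)
  show ?case
  proof (rule symmetric_paths_step[OF a])
    show "ainv l \<in> alg_A j" if "l \<in> {a + 1..pr (a + 1)}" for l
      using l[OF that] j_le upper_bounds by (intro ainv_alg_A) (auto simp: prec_iff_upper)
    have "a + 1 < j" "2 * (a + 1) \<noteq> N + 1"
      using a upper_bounds N_eq by (cases "odd N"; auto)+
    then show "smul (ainv (a + 1) + ainv (pr (a + 1))
        + (hconst q - hconst qbar) * ainv (a + 1) * ainv (pr (a + 1))) x \<in> div_ideal"
      if "x \<in> int_alg" for x
      using ainv_reflect[of "a + 1"] ainv_pr_div_ideal[OF that] step assms(1) by simp
    show "cong.paths ainv F (a + 1) [a + 2..<pr (a + 1)] (pr (a + 1)) \<in> div_ideal"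
      using step.IH by simp
  qed
qed

lemma paths_div_ideal_upper:
  assumes "1 \<le> i" "i \<le> pr j"
  shows "cong.paths ainv F i [i + 1..<j] j \<in> div_ideal"
proof -
  have j: "pr (pr j) = j"
    using j_le by (simp add: pr_pr)
  have t: "cong.paths ainv F (pr j) [pr j + 1..<j] j \<in> div_ideal"
    using symmetric_paths[of "pr j"] upper_bounds by (simp add: j)
  have M: "cong.paths ainv F i' ls k \<in> int_alg" if "set ls \<subseteq> {1..<j}" for i' k ls
    using that j_le upper_bounds by (intro cong.paths_M ainv_alg_A) (auto simp: prec_iff_upper)
  show ?thesis
  proof (cases "i = pr j")
    case True
    with t show ?thesis
      by simp
  next
    case False
    then have "i + 1 \<le> pr j" "pr j < j"
      using assms upper_bounds by auto
    then have "[i + 1..<j] = [i + 1..<pr j] @ pr j # [pr j + 1..<j]"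
      using upt_add_eq_append[of "i + 1" "pr j" "j - pr j"] upt_conv_Cons[of "pr j" j] by simp
    then have "cong.paths ainv F i [i + 1..<j] j =
        smul (ainv (pr j)) (cong.paths ainv F i ([i + 1..<pr j] @ [pr j + 1..<j]) j)
        + cong.paths ainv F i [i + 1..<pr j] (pr j) * cong.paths ainv F (pr j) [pr j + 1..<j] j"
      by (simp only: cong.paths_append)
    also have "\<dots> \<in> div_ideal"
      using t upper_bounds by (intro cong.J_add cong.J_mult_left ainv_pr_div_ideal M) auto
    finally show ?thesis .
  qed
qed

end

section \<open>From \<open>fcheck\<close> to path sums, and the conclusion in the quotient\<close>

lemma delta_minus_lower: "j < pr s \<Longrightarrow> delta_minus j = 1"
  by (simp add: delta_minus_def)

lemma transp_prec: "transp prec"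
  by (rule transpI) (auto simp: prec_def)

lemma route_prod_eq_ext:
  "1 \<le> i \<Longrightarrow> set m \<subseteq> {1..N} \<Longrightarrow> cong.route_prod F i m j = ext (f_route i m j)"
  using j_le by (induction m arbitrary: i) (auto simp: F_def ext_mult)

lemma F_incomparable: "i < k \<Longrightarrow> \<not> prec i k \<Longrightarrow> F i k = 0"
  using F_even_middle(1) N_eq by (auto simp: prec_def pr_def)

text \<open>A chain that increases for \<open><\<close> but not for \<open>prec\<close> must step
  from \<open>n\<close> directly to its mirror image, and that factor is 0.\<close>

lemma route_prod_not_route:
  assumes "sorted_wrt (<) (i # m @ [k])" "\<not> sorted_wrt prec (i # m @ [k])"
  shows "cong.route_prod F i m k = 0"
  using assms
proof (induction m arbitrary: i)
  case Nil
  then show ?case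
    using F_incomparable by simp
next
  case (Cons x m)
  show ?case
  proof (cases "prec i x")
    case True
    have "\<not> sorted_wrt prec (x # m @ [k])"
    proof
      assume "sorted_wrt prec (x # m @ [k])"
      then have "sorted_wrt prec (i # x # m @ [k])"
        using True transp_prec by (simp only: sorted_wrt2)
      with Cons.prems show False
        by simp
    qed
    with Cons show ?thesis
      by simp
  next
    case False
    with Cons.prems show ?thesis
      using F_incomparable[of i x] by simp
  qed
qed

text \<open>The product of all inverses cancels the \<open>A\<close> of the start and of every
  visited index, leaving the inverses at the skipped ones. The filter discards indices incomparable
  to \<open>i\<close> or \<open>j\<close>, which occur neither in routes nor in the product.\<close>

lemma fhat_eq_paths:
  assumes i: "1 \<le> i" "prec i j"
  shows "fhat i j * scal (\<Prod>l\<in>{l \<in> {1..N}. preceq i l \<and> prec l j}. inverse (A l j)) =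
    cong.paths ainv F i (filter (\<lambda>l. prec i l \<and> prec l j) [i + 1..<j]) j"
proof -
  define L where "L = filter (\<lambda>l. prec i l \<and> prec l j) [i + 1..<j]"
  have ij: "i < j"
    using i by (simp add: prec_def)
  have L_sorted: "sorted_wrt (<) L" and L_distinct: "distinct L"
    by (simp_all add: L_def sorted_wrt_filter)
  have L_set: "set L = {l. prec i l \<and> prec l j}"
    by (auto simp: L_def prec_def)
  have index_set: "{l \<in> {1..N}. preceq i l \<and> prec l j} = insert i (set L)"
    using i j_le by (auto simp: L_set preceq_def prec_def)
  define p where "p = (\<Prod>l\<in>insert i (set L). ainv l)"
  have routes: "routes i j = {m \<in> set (subseqs L). sorted_wrt prec (i # m @ [j])}"
  proof -
    have "sorted_wrt (<) m" if "sorted_wrt prec m" for m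
      using that by (rule sorted_wrt_mono_rel[rotated]) (simp add: prec_def)
    moreover have "l \<in> {1..N}" if "prec i l" "prec l j" for l
      using that i j_le by (auto simp: prec_def)
    ultimately show ?thesis
      by (auto simp: routes_def set_subseqs_sorted[OF L_sorted] L_set sorted_wrt_append)
  qed
  have summand: "tens (f_route i m j) (\<Prod>l\<leftarrow>i # m. A l j) * scal p
      = smul (prod ainv (set L - set m)) (cong.route_prod F i m j)" if "m \<in> routes i j" for m
  proof -
    have m: "set m \<subseteq> set L" "distinct m" "i \<notin> set L"
      using that L_distinct cong.set_subseqs_subset[of m L] subseqs_distinctD[of m L]
      by (auto simp: routes) (auto simp: L_set prec_def)
    have mN: "set m \<subseteq> {1..N}"
      using that by (simp add: routes_def)
    have AA: "A l j * ainv l = 1" if "l \<in> insert i (set m)" for l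
      using that m i ij j_le by (intro A_ainv) (auto simp: L_set prec_def)
    have "insert i (set L) = insert i (set m) \<union> (set L - set m)"
      using m by auto
    moreover have "prod ainv (insert i (set m) \<union> (set L - set m))
        = prod ainv (insert i (set m)) * prod ainv (set L - set m)"
      using m by (intro prod.union_disjoint) auto
    ultimately have "p = prod ainv (insert i (set m)) * prod ainv (set L - set m)"
      by (simp only: p_def)
    moreover have "(\<Prod>l\<leftarrow>i # m. A l j) = (\<Prod>l\<in>insert i (set m). A l j)"
      using m by (subst prod.distinct_set_conv_list[symmetric]) auto
    moreover have "(\<Prod>l\<in>insert i (set m). A l j) * prod ainv (insert i (set m)) = 1"
      unfolding prod.distrib[symmetric] using AA by (intro prod.neutral) blast
    ultimately have "(\<Prod>l\<leftarrow>i # m. A l j) * p = prod ainv (set L - set m)"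
      by (simp only: mult_1_left flip: mult.assoc)
    moreover have "tens (f_route i m j) (\<Prod>l\<leftarrow>i # m. A l j) * scal p
        = smul ((\<Prod>l\<leftarrow>i # m. A l j) * p) (ext (f_route i m j))"
      unfolding tens_eq_smul[of _ "\<Prod>l\<leftarrow>i # m. A l j"] scal_central[symmetric]
      by (simp add: smul_def mult_single mult.commute flip: mult.assoc)
    ultimately show ?thesis
      using route_prod_eq_ext[OF i(1) mN] by simp
  qed
  have "fhat i j * scal p = (\<Sum>m\<in>routes i j. smul (prod ainv (set L - set m)) (cong.route_prod F i m j))"
    using i ij summand by (simp add: fhat_def sum_distrib_right del: list.map prod_list.Cons)
  also have "\<dots> = (\<Sum>m\<in>set (subseqs L). smul (prod ainv (set L - set m)) (cong.route_prod F i m j))"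
  \<comment> \<open>The subsequences added here are increasing chains that are not routes, so they
    contribute 0.\<close>
  proof (intro sum.mono_neutral_left ballI)
    fix m assume m: "m \<in> set (subseqs L) - routes i j"
    then have "sorted_wrt (<) (i # m @ [j])"
      using ij by (auto simp: set_subseqs_sorted[OF L_sorted] L_set sorted_wrt_append prec_def)
    with m have "cong.route_prod F i m j = 0"
      by (intro route_prod_not_route) (auto simp: routes)
    then show "smul (prod ainv (set L - set m)) (cong.route_prod F i m j) = 0"
      by simp
  qed (auto simp: routes)
  also have "\<dots> = cong.paths ainv F i L j"
    by (rule cong.paths_eq_sum[OF L_distinct, symmetric])
  finally show ?thesis
    by (simp only: p_def L_def index_set ainv_def)
qed

lemma fcheck_representative:
  assumes i: "1 \<le> i" "i \<le> pr j"
  shows "fhat i j * scal (\<Prod>l\<in>{l \<in> {1..N}. preceq i l \<and> prec l j}. inverse (A l j)) \<in> div_ideal"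
proof (cases "prec i j")
  case True
  define L where "L = filter (\<lambda>l. prec i l \<and> prec l j) [i + 1..<j]"
  have "cong.paths ainv F i L j \<in> div_ideal"
  proof (cases "j < pr s")
    case lower: True
    have "cong.paths ainv F i L j \<in> int_alg"
      using i j_le by (intro cong.paths_M ainv_alg_A) (auto simp: L_def prec_def)
    from delta_div_ideal[OF this] show ?thesis
      by (simp add: delta_minus_lower[OF lower])
  next
    case False
    then have upper: "pr s \<le> j"
      by simp
    \<comment> \<open>For even \<open>N\<close> one has \<open>i < n\<close> and
      \<open>j \<ge> n + 2\<close>, so neither end belongs to the incomparable pair and nothing is
      filtered out.\<close>
    have "L = [i + 1..<j]"
      unfolding L_def using upper_bounds[OF upper] i
      by (intro filter_True) (auto simp: prec_def s_def split: if_splits)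
    then show ?thesis
      using paths_div_ideal_upper[OF upper i] by simp
  qed
  then show ?thesis
    using fhat_eq_paths[OF i(1) True] by (simp add: L_def)
next
  case False
  show ?thesis
  proof (cases "i = j")
    case True
    \<comment> \<open>\<open>i = j\<close> is at most its own mirror image, hence in the lower half
      or the middle, where \<open>delta_minus j\<close> is 1.\<close>
    have "j < pr s"
      using True i N_eq rank_pos by (cases "odd N") (auto simp: pr_def s_def)
    then have "1 \<in> div_ideal"
      using delta_div_ideal[OF int_alg_1] by (simp add: delta_minus_lower)
    moreover have "{l \<in> {1..N}. preceq i l \<and> prec l j} = {}"
      using True by (auto simp: preceq_def prec_def)
    ultimately show ?thesis
      by (simp only: True) (simp add: fhat_def)
  next
    case neq: False
    with False have "fhat i j = 0"
      by (simp add: fhat_def)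
    then show ?thesis
      by simp
  qed
qed

lemma fcheck_divisible:
  assumes i: "1 \<le> i" "i \<le> pr j"
  shows "\<exists>u\<in>Uq_tensor (alg_A j). fcheck i j = u \<otimes>\<^bsub>UqK\<^esub> cls (scal (delta_minus j))"
proof -
  define x where "x = fhat i j * scal (\<Prod>l\<in>{l \<in> {1..N}. preceq i l \<and> prec l j}. inverse (A l j))"
  obtain m t where m: "m \<in> int_alg" and t: "t \<in> serreK" and x: "x = smul (delta_minus j) m + t"
    using fcheck_representative[OF i] by (auto simp: x_def div_ideal_def)
  interpret ideal serreK "free_ring n"
    by (rule ideal_serreK)
  have mc: "m \<in> carrier (free_ring n)" "scal (delta_minus j) \<in> carrier (free_ring n)"
    "t \<in> carrier (free_ring n)"
    using int_alg_carrier[OF m] free_ring_closed(3) Icarr[OF t] by auto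
  have eq: "smul (delta_minus j) m = m * scal (delta_minus j)"
    by (simp add: smul_def scal_central)
  have c: "m * scal (delta_minus j) \<in> carrier (free_ring n)" "x \<in> carrier (free_ring n)"
    unfolding x eq using mc by (simp_all add: free_ring_closed)
  \<comment> \<open>The difference is the Serre part \<open>t\<close>, so the two representatives
    have the same class and \<open>cls m\<close> is the required quotient.\<close>
  have "x \<ominus>\<^bsub>free_ring n\<^esub> (m * scal (delta_minus j)) \<in> serreK"
    unfolding free_ring_minus[OF c(2,1)] using t by (simp add: x eq)
  then have "cls x = cls (m * scal (delta_minus j))"
    unfolding cls_def using c ring.quotient_eq_iff_same_a_r_cos[OF ring_free_ring ideal_serreK] by blast
  also have "\<dots> = cls m \<otimes>\<^bsub>UqK\<^esub> cls (scal (delta_minus j))"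
    using rcoset_mult_add[OF mc(1,2)] by (simp add: UqK_def FactRing_def cls_def free_ring_simps)
  finally have "fcheck i j = cls m \<otimes>\<^bsub>UqK\<^esub> cls (scal (delta_minus j))"
    by (simp add: fcheck_def x_def)
  moreover have "cls m \<in> Uq_tensor (alg_A j)"
    using m by (auto simp: Uq_tensor_def int_alg_def)
  ultimately show ?thesis
    by blast
qed

end

theorem lemma3p5:
  fixes N i j :: nat and q logq :: complex
  assumes "N \<ge> 3" and "N \<noteq> 4"
    and "q \<noteq> 0" and "exp logq = q" and "\<And>k. k \<ge> 1 \<Longrightarrow> q ^ k \<noteq> 1"
    and "i \<in> {1..N}" and "j \<in> {1..N}" and "i \<le> N + 1 - j"
  shows "\<exists>u \<in> quantum_so.Uq_tensor N logq (quantum_so.alg_A N logq j).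
    quantum_so.fcheck N logq i j =
      u \<otimes>\<^bsub>quantum_so.UqK N logq\<^esub> quantum_so.cls N logq (scal (quantum_so.delta_minus N logq j))"
proof -
  have "quantum_so.q logq = q"
    using assms(4) by (simp add: quantum_so.q_def quantum_so.qpow_def)
  then interpret so_column N logq j
    using assms by unfold_locales auto
  show ?thesis
    using assms by (intro fcheck_divisible) (auto simp: pr_def)
qed

end
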